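(* (Gödel's Completeness Theorem for quantifier algebras.) Let $\mathbf A$ be a locally finite quantifier algebra over an infinite set $X$. (a) Let $J$ be a consistent subset of $\mathbf A_*(X)$. Then there is a $2$-model $\mathbf B$ of $\mathbf A$ and a map $\sigma:X\to\mathbf B^*(\emptyset)$ such that $p\sigma=1$ for every $p\in J$. (b) If $p,q\in\mathbf A_*(X)$ and $p\neq q$, then there is a $2$-model $\mathbf B$ of $\mathbf A$ and a map $\sigma:X\to\mathbf B^*(\emptyset)$ such that $p\sigma\neq q\sigma$.
   Context: Throughout, $\mathcal S$ is a nonempty collection of sets containing at least one infinite set; $X,Y,Z,W$ denote members of $\mathcal S$ (sets of variables). Quantifier theory. A quantifier theory $\mathbf A$ over $\mathcal S$ consists of: a set $\mathbf A^*(X)$ and a map $\epsilon_X:X\to\mathbf A^*(X)$ for each $X$ (one writes $x$ for $\epsilon_X(x)$); a Boolean algebra $\mathbf A_*(X)$ for each $X$; an element $a\sigma\in\mathbf A^*(Y)$ for each nonempty $X$, $a\in\mathbf A^*(X)$ and map $\sigma:X\to\mathbf A^*(Y)$; an element $p\sigma\in\mathbf A_*(Y)$ for each nonempty $X$, $p\in\mathbf A_*(X)$ and map $\sigma:X\to\mathbf A^*(Y)$; an element $\forall x.p\in\mathbf A_*(X)$ for each nonempty $X$, $x\in X$, $p\in\mathbf A_*(X)$. Put $\mathbf A(X)=\mathbf A_*(X)\cup\mathbf A^*(X)$. For all nonempty $X$, $x\in X$, $t\in\mathbf A(X)$, $\sigma:X\to\mathbf A^*(Y)$, $p,q\in\mathbf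 A_*(X)$ the following hold. (P1) $t\epsilon_X=t$. (P2) $(t\sigma)\tau=t(\sigma\tau)$ if $Y$ is nonempty and $\tau:Y\to\mathbf A^*(W)$, where $(\sigma\tau)(x)=\sigma(x)\tau$. (P3) $x\sigma=\sigma(x)$. (P4) $p\mapsto p\sigma$ is a homomorphism of Boolean algebras $\mathbf A_*(X)\to\mathbf A_*(Y)$. (P5) $(\forall x.p)\sigma=\forall y.(p\sigma^{y/x})$ whenever $y,z\in Y$, $y\ne z$ and $\sigma[z/y]=\sigma$. (Q1) $\forall x.(p\wedge q)=\forall x.p\wedge\forall x.q$. (Q2) $\forall x.p\le p$. (Q3) $\forall x.p=p$ if $p[y/x]=p$ for some $y\in X$, $y\neq x$. Notation: for $y\in Y$ and $d\in\mathbf A^*(Y)$, $[d/y]:Y\to\mathbf A^*(Y)$ sends $y$ to $d$ and every other variable to itself; for $d\in \mathbf A^*(Y)$, $\sigma^{d/x}:X\to\mathbf A^*(Y)$ sends $x$ to $d$ and agrees with $\sigma$ elsewhere. A quantifier algebra over $X$ is a quantifier theory over $\mathcal S=\{X\}$. Supports. For nonempty $X$ and $t\in\mathbf A(X)$, a subset $U\subseteq X$ is a support for $t$ if $t\sigma=t\tau$ for all $Y$ and all $\sigma,\tau:X\to\mathbf A^*(Y)$ with $\sigma|_U=\tau|_U$; $t$ is closed if $\emptyset$ is a support for $t$ (elements of $\mathbf A(\emptyset)$ are by definition closed). $\mathbf A$ is locally finite if every element of every $\mathbf A(X)$ has a finite support. Standing convention: every quantifier theory considered is nontrivial, meaning that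 $\mathbf A_*(X)$ has a non-closed element for some nonempty $X\in\mathcal S$. Models. A quantifier model is a quantifier theory $\mathbf B$ over a collection containing $\emptyset$ such that (M1) $\mathbf B^*(\emptyset)\neq\emptyset$ and $\mathbf B_*(\emptyset)$ is a nontrivial Boolean algebra ($0\ne1$); (M2) for nonempty $X$, $x\in X$, $p\in\mathbf B_*(X)$, $\sigma:X\to\mathbf B^*(\emptyset)$, the infimum $\bigwedge_{d\in\mathbf B^*(\emptyset)}p\sigma^{d/x}$ exists in $\mathbf B_*(\emptyset)$ and equals $(\forall x.p)\sigma$. It is a $2$-model if $\mathbf B_*(\emptyset)=2=\{0,1\}$. A $2$-model of a quantifier theory $\mathbf A$ over $\mathcal S$ is a $2$-model $\mathbf B$ over $\mathcal S\cup\{\emptyset\}$ whose restriction to $\mathcal S\setminus\{\emptyset\}$ equals that of $\mathbf A$. A subset of a Boolean algebra is consistent if it is contained in a proper filter (equivalently, finite meets of its elements are nonzero). *)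

theory Defs
  imports "HOL-Algebra.Lattice" "HOL-Library.FuncSet"
begin

section \<open>Boolean algebras with explicit carrier\<close>

locale boolean_lattice = bounded_lattice L for L (structure) +
  assumes meet_join_distrib:
      "\<lbrakk>x \<in> carrier L; y \<in> carrier L; z \<in> carrier L\<rbrakk>
        \<Longrightarrow> x \<sqinter> (y \<squnion> z) = (x \<sqinter> y) \<squnion> (x \<sqinter> z)"
    and complement_exists:
      "x \<in> carrier L \<Longrightarrow> \<exists>y\<in>carrier L. x \<sqinter> y = \<bottom> \<and> x \<squnion> y = \<top>"

text \<open>Preservation of complements is automatic, complements being unique in a Boolean algebra.\<close>

definition boolean_hom :: "'b gorder \<Rightarrow> 'c gorder \<Rightarrow> ('b \<Rightarrow> 'c) \<Rightarrow> bool" where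
  "boolean_hom L M h \<longleftrightarrow>
     h \<in> carrier L \<rightarrow> carrier M \<and> meet_pres L M h \<and> join_pres L M h \<and>
     h \<bottom>\<^bsub>L\<^esub> = \<bottom>\<^bsub>M\<^esub> \<and> h \<top>\<^bsub>L\<^esub> = \<top>\<^bsub>M\<^esub>"

definition lattice_filter :: "'b gorder \<Rightarrow> 'b set \<Rightarrow> bool" where
  "lattice_filter L F \<longleftrightarrow>
     F \<subseteq> carrier L \<and> F \<noteq> {} \<and>
     (\<forall>p\<in>F. \<forall>q\<in>F. p \<sqinter>\<^bsub>L\<^esub> q \<in> F) \<and>
     (\<forall>p\<in>F. \<forall>q\<in>carrier L. p \<sqsubseteq>\<^bsub>L\<^esub> q \<longrightarrow> q \<in> F)"

definition consistent :: "'b gorder \<Rightarrow> 'b set \<Rightarrow> bool" where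
  "consistent L J \<longleftrightarrow> (\<exists>F. lattice_filter L F \<and> F \<noteq> carrier L \<and> J \<subseteq> F)"


section \<open>Quantifier theories\<close>

text \<open>
  In the ordinary notation, \<open>terms A X\<close> is \<open>A\<^sup>*(X)\<close>, \<open>forms A X\<close> is the Boolean algebra
  \<open>A\<^sub>*(X)\<close>, \<open>var A X\<close> is the map \<open>\<epsilon>\<close> of \<open>X\<close>, and \<open>tsubst A X Y a \<sigma>\<close>, \<open>psubst A X Y p \<sigma>\<close> are
  \<open>a\<sigma>\<close>, \<open>p\<sigma>\<close> for \<open>\<sigma> : X \<rightarrow> A\<^sup>*(Y)\<close>. Maps out of \<open>X\<close> are represented by the extensional functions
  \<open>X \<rightarrow>\<^sub>E terms A Y\<close>, so that equality of maps is equality of functions.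
  Then \<open>\<sigma>(x := d)\<close> is \<open>\<sigma>\<close> with the value at \<open>x \<in> X\<close> changed to \<open>d\<close>, and \<open>(var A Y)(y := d)\<close>
  is the substitution \<open>[d/y]\<close>.
\<close>

record ('v, 'a, 'b) qtheory =
  terms :: "'v set \<Rightarrow> 'a set"
  forms :: "'v set \<Rightarrow> 'b gorder"
  var :: "'v set \<Rightarrow> 'v \<Rightarrow> 'a"
  tsubst :: "'v set \<Rightarrow> 'v set \<Rightarrow> 'a \<Rightarrow> ('v \<Rightarrow> 'a) \<Rightarrow> 'a"
  psubst :: "'v set \<Rightarrow> 'v set \<Rightarrow> 'b \<Rightarrow> ('v \<Rightarrow> 'a) \<Rightarrow> 'b"
  univ :: "'v set \<Rightarrow> 'v \<Rightarrow> 'b \<Rightarrow> 'b"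

text \<open>The composite \<open>\<sigma>\<tau>\<close> of \<open>\<sigma> : X \<rightarrow> A\<^sup>*(Y)\<close> and \<open>\<tau> : Y \<rightarrow> A\<^sup>*(W)\<close>.\<close>

definition scomp ::
  "('v, 'a, 'b) qtheory \<Rightarrow> 'v set \<Rightarrow> 'v set \<Rightarrow> 'v set \<Rightarrow> ('v \<Rightarrow> 'a) \<Rightarrow> ('v \<Rightarrow> 'a) \<Rightarrow> 'v \<Rightarrow> 'a" where
  "scomp A X Y W \<sigma> \<tau> = (\<lambda>x\<in>X. tsubst A Y W (\<sigma> x) \<tau>)"

locale pre_quantifier_theory =
  fixes S :: "'v set set" and A :: "('v, 'a, 'b) qtheory"
  assumes infinite_member: "\<exists>X\<in>S. infinite X"
    and var_type: "X \<in> S \<Longrightarrow> var A X \<in> X \<rightarrow>\<^sub>E terms A X"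
    and forms_boolean: "X \<in> S \<Longrightarrow> boolean_lattice (forms A X)"
    and tsubst_type:
      "\<lbrakk>X \<in> S; X \<noteq> {}; Y \<in> S; a \<in> terms A X; \<sigma> \<in> X \<rightarrow>\<^sub>E terms A Y\<rbrakk>
        \<Longrightarrow> tsubst A X Y a \<sigma> \<in> terms A Y"
    and psubst_type:
      "\<lbrakk>X \<in> S; X \<noteq> {}; Y \<in> S; p \<in> carrier (forms A X); \<sigma> \<in> X \<rightarrow>\<^sub>E terms A Y\<rbrakk>
        \<Longrightarrow> psubst A X Y p \<sigma> \<in> carrier (forms A Y)"
    and univ_type:
      "\<lbrakk>X \<in> S; x \<in> X; p \<in> carrier (forms A X)\<rbrakk> \<Longrightarrow> univ A X x p \<in> carrier (forms A X)"
    and P1_term: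
      "\<lbrakk>X \<in> S; X \<noteq> {}; a \<in> terms A X\<rbrakk> \<Longrightarrow> tsubst A X X a (var A X) = a"
    and P1_form:
      "\<lbrakk>X \<in> S; X \<noteq> {}; p \<in> carrier (forms A X)\<rbrakk> \<Longrightarrow> psubst A X X p (var A X) = p"
    and P2_term:
      "\<lbrakk>X \<in> S; X \<noteq> {}; Y \<in> S; Y \<noteq> {}; W \<in> S; a \<in> terms A X;
        \<sigma> \<in> X \<rightarrow>\<^sub>E terms A Y; \<tau> \<in> Y \<rightarrow>\<^sub>E terms A W\<rbrakk>
        \<Longrightarrow> tsubst A Y W (tsubst A X Y a \<sigma>) \<tau> = tsubst A X W a (scomp A X Y W \<sigma> \<tau>)"
    and P2_form:
      "\<lbrakk>X \<in> S; X \<noteq> {}; Y \<in> S; Y \<noteq> {}; W \<in> S; p \<in> carrier (forms A X);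
        \<sigma> \<in> X \<rightarrow>\<^sub>E terms A Y; \<tau> \<in> Y \<rightarrow>\<^sub>E terms A W\<rbrakk>
        \<Longrightarrow> psubst A Y W (psubst A X Y p \<sigma>) \<tau> = psubst A X W p (scomp A X Y W \<sigma> \<tau>)"
    and P3:
      "\<lbrakk>X \<in> S; x \<in> X; Y \<in> S; \<sigma> \<in> X \<rightarrow>\<^sub>E terms A Y\<rbrakk> \<Longrightarrow> tsubst A X Y (var A X x) \<sigma> = \<sigma> x"
    and P4:
      "\<lbrakk>X \<in> S; X \<noteq> {}; Y \<in> S; \<sigma> \<in> X \<rightarrow>\<^sub>E terms A Y\<rbrakk>
        \<Longrightarrow> boolean_hom (forms A X) (forms A Y) (\<lambda>p. psubst A X Y p \<sigma>)"
    and P5: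
      "\<lbrakk>X \<in> S; x \<in> X; Y \<in> S; p \<in> carrier (forms A X); \<sigma> \<in> X \<rightarrow>\<^sub>E terms A Y;
        y \<in> Y; z \<in> Y; y \<noteq> z; scomp A X Y Y \<sigma> ((var A Y)(y := var A Y z)) = \<sigma>\<rbrakk>
        \<Longrightarrow> psubst A X Y (univ A X x p) \<sigma> = univ A Y y (psubst A X Y p (\<sigma>(x := var A Y y)))"
    and Q1:
      "\<lbrakk>X \<in> S; x \<in> X; p \<in> carrier (forms A X); q \<in> carrier (forms A X)\<rbrakk>
        \<Longrightarrow> univ A X x (p \<sqinter>\<^bsub>forms A X\<^esub> q) = univ A X x p \<sqinter>\<^bsub>forms A X\<^esub> univ A X x q"
    and Q2:
      "\<lbrakk>X \<in> S; x \<in> X; p \<in> carrier (forms A X)\<rbrakk> \<Longrightarrow> univ A X x p \<sqsubseteq>\<^bsub>forms A X\<^esub> p"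
    and Q3:
      "\<lbrakk>X \<in> S; x \<in> X; p \<in> carrier (forms A X); y \<in> X; y \<noteq> x;
        psubst A X X p ((var A X)(x := var A X y)) = p\<rbrakk> \<Longrightarrow> univ A X x p = p"


section \<open>Supports\<close>

definition term_support ::
  "'v set set \<Rightarrow> ('v, 'a, 'b) qtheory \<Rightarrow> 'v set \<Rightarrow> 'a \<Rightarrow> 'v set \<Rightarrow> bool" where
  "term_support S A X a U \<longleftrightarrow> U \<subseteq> X \<and>
     (\<forall>Y\<in>S. \<forall>\<sigma>\<in>X \<rightarrow>\<^sub>E terms A Y. \<forall>\<tau>\<in>X \<rightarrow>\<^sub>E terms A Y.
        (\<forall>x\<in>U. \<sigma> x = \<tau> x) \<longrightarrow> tsubst A X Y a \<sigma> = tsubst A X Y a \<tau>)"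

definition form_support ::
  "'v set set \<Rightarrow> ('v, 'a, 'b) qtheory \<Rightarrow> 'v set \<Rightarrow> 'b \<Rightarrow> 'v set \<Rightarrow> bool" where
  "form_support S A X p U \<longleftrightarrow> U \<subseteq> X \<and>
     (\<forall>Y\<in>S. \<forall>\<sigma>\<in>X \<rightarrow>\<^sub>E terms A Y. \<forall>\<tau>\<in>X \<rightarrow>\<^sub>E terms A Y.
        (\<forall>x\<in>U. \<sigma> x = \<tau> x) \<longrightarrow> psubst A X Y p \<sigma> = psubst A X Y p \<tau>)"

text \<open>
  Supports are only defined for nonempty \<open>X\<close>; the elements over the empty set of variables
  are closed by convention and impose no condition below.
\<close>

definition locally_finite :: "'v set set \<Rightarrow> ('v, 'a, 'b) qtheory \<Rightarrow> bool" where
  "locally_finite S A \<longleftrightarrow>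
     (\<forall>X\<in>S. X \<noteq> {} \<longrightarrow>
        (\<forall>a\<in>terms A X. \<exists>U. finite U \<and> term_support S A X a U) \<and>
        (\<forall>p\<in>carrier (forms A X). \<exists>U. finite U \<and> form_support S A X p U))"

text \<open>Quantifier theories are nontrivial by convention.\<close>

locale quantifier_theory = pre_quantifier_theory S A
  for S :: "'v set set" and A :: "('v, 'a, 'b) qtheory" +
  assumes nontrivial:
    "\<exists>X\<in>S. X \<noteq> {} \<and> (\<exists>p\<in>carrier (forms A X). \<not> form_support S A X p {})"

abbreviation quantifier_algebra :: "'v set \<Rightarrow> ('v, 'a, 'b) qtheory \<Rightarrow> bool" where
  "quantifier_algebra X A \<equiv> quantifier_theory {X} A"


section \<open>Models\<close>

locale quantifier_model = quantifier_theory S B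
  for S :: "'v set set" and B :: "('v, 'a, 'b) qtheory" +
  assumes empty_member: "{} \<in> S"
    and M1_terms: "terms B {} \<noteq> {}"
    and M1_forms: "\<bottom>\<^bsub>forms B {}\<^esub> \<noteq> \<top>\<^bsub>forms B {}\<^esub>"
    and M2:
      "\<lbrakk>X \<in> S; x \<in> X; p \<in> carrier (forms B X); \<sigma> \<in> X \<rightarrow>\<^sub>E terms B {}\<rbrakk>
        \<Longrightarrow> is_glb (forms B {}) (psubst B X {} (univ B X x p) \<sigma>)
              ((\<lambda>d. psubst B X {} p (\<sigma>(x := d))) ` terms B {})"

locale two_model = quantifier_model S B
  for S :: "'v set set" and B :: "('v, 'a, 'b) qtheory" +
  assumes two: "carrier (forms B {}) = {\<bottom>\<^bsub>forms B {}\<^esub>, \<top>\<^bsub>forms B {}\<^esub>}"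

text \<open>
  A model of \<open>A\<close> has the terms and formulas of \<open>A\<close> over every nonempty set of variables, and in
  addition a domain \<open>B\<^sup>*(\<emptyset>)\<close>, which in general does not fit into the type \<open>'a\<close> of the terms of \<open>A\<close>.
  The terms of \<open>B\<close> therefore live in a sum type \<open>'a + 'c\<close>, and the restriction of \<open>B\<close> equals \<open>A\<close>
  up to the injection \<open>Inl\<close> of the terms of \<open>A\<close>; the formulas are literally the same.
  Since only values on the carriers are meaningful, only these are compared.
\<close>

definition restriction_equals ::
  "'v set set \<Rightarrow> ('v, 'a, 'b) qtheory \<Rightarrow> ('v, 'a + 'c, 'b) qtheory \<Rightarrow> bool" where
  "restriction_equals T A B \<longleftrightarrow>
     (\<forall>X\<in>T.
        terms B X = Inl ` terms A X \<and>
        carrier (forms B X) = carrier (forms A X) \<and>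
        (\<forall>p\<in>carrier (forms A X). \<forall>q\<in>carrier (forms A X).
           p \<sqsubseteq>\<^bsub>forms B X\<^esub> q \<longleftrightarrow> p \<sqsubseteq>\<^bsub>forms A X\<^esub> q) \<and>
        (\<forall>x\<in>X. var B X x = Inl (var A X x)) \<and>
        (\<forall>x\<in>X. \<forall>p\<in>carrier (forms A X). univ B X x p = univ A X x p) \<and>
        (\<forall>Y\<in>T. \<forall>\<sigma>\<in>X \<rightarrow>\<^sub>E terms A Y.
           (\<forall>a\<in>terms A X.
              tsubst B X Y (Inl a) (\<lambda>x\<in>X. Inl (\<sigma> x)) = Inl (tsubst A X Y a \<sigma>)) \<and>
           (\<forall>p\<in>carrier (forms A X).
              psubst B X Y p (\<lambda>x\<in>X. Inl (\<sigma> x)) = psubst A X Y p \<sigma>)))"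

definition two_model_of ::
  "'v set set \<Rightarrow> ('v, 'a, 'b) qtheory \<Rightarrow> ('v, 'a + 'c, 'b) qtheory \<Rightarrow> bool" where
  "two_model_of S A B \<longleftrightarrow>
     two_model (insert {} S) B \<and> restriction_equals (S - {{}}) A B"

text \<open>
  The room provided for the domain of a model. As HOL cannot quantify over types inside a
  formula, a type large enough for every quantifier algebra with terms in \<open>'a\<close> and formulas in
  \<open>'b\<close> has to be named. A domain may need as many elements as there are formulas and terms;
  sets of lists leave space for classes of terms with finitely many parameters.
\<close>

type_synonym ('a, 'b) room = "('a + 'b) list set"

end

theory Submission
  imports Defs
begin

text \<open>
  The proof is Henkin's. Parameters are added to the algebra without constructing an extended
  algebra: a term or formula with parameters from a set \<open>V\<close> is a function of the assignments
  \<open>h : V \<rightarrow> A\<^sup>*(X)\<close>, with values in \<open>A\<^sup>*(X)\<close> or \<open>A\<^sub>*(X)\<close>, and its algebraic operations are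
  pointwise. A set of such formulas is satisfiable if for each finite part of it there are one
  assignment and one nonzero element of \<open>A\<^sub>*(X)\<close> below the values of all its members. As a fresh
  parameter \<open>w\<close> can be assigned a fresh variable \<open>y\<close>, and \<open>q \<le> p[y/x]\<close> implies \<open>q \<le> \<forall>x.p\<close> for \<open>y\<close>
  not in \<open>q\<close>, the Henkin axioms \<open>p[w/x] \<rightarrow> \<forall>x.p\<close> are satisfiable together with the given
  consistent set. A maximal satisfiable set that contains them decides each formula and makes
  quantifiers range over the terms with parameters, which form the domain of the model.
\<close>

section \<open>Boolean algebras\<close>

text \<open>The usual Henkin construction adds witnesses in infinitely many rounds, since each round
  brings new formulas that need witnesses of their own. Here one round suffices: parameters are
  lists over \<open>'a + 'b\<close>, and the data of a Henkin axiom, namely the variable, the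
  formula and the terms instantiated on its support, can be written as such a list, which then
  serves as the witness. The circularity is harmless because a witness is longer than every
  parameter used in its data. Only finite parts can be treated at a time: a fresh variable exists
  relative to finitely many terms, and there may be far more formulas than variables. No single
  assignment has to satisfy all Henkin axioms. Lists also settle the size of the domain. A term with
  parameters is coded by its value at one assignment and the parameters it depends on, so the domain
  embeds in \<open>room\<close>, a type that the theorem fixes beforehand.\<close>

context boolean_lattice
begin

definition compl :: "'a \<Rightarrow> 'a" where
  "compl x = (SOME y. y \<in> carrier L \<and> x \<sqinter> y = \<bottom> \<and> x \<squnion> y = \<top>)"

lemma compl:
  assumes "x \<in> carrier L"
  shows compl_closed: "compl x \<in> carrier L"
    and meet_compl: "x \<sqinter> compl x = \<bottom>"
    and join_compl: "x \<squnion> compl x = \<top>"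
proof -
  have "\<exists>y. y \<in> carrier L \<and> x \<sqinter> y = \<bottom> \<and> x \<squnion> y = \<top>"
    using complement_exists[OF assms] by blast
  from someI_ex[OF this] show "compl x \<in> carrier L" "x \<sqinter> compl x = \<bottom>" "x \<squnion> compl x = \<top>"
    unfolding compl_def by auto
qed

lemma antisym: "\<lbrakk>x \<sqsubseteq> y; y \<sqsubseteq> x; x \<in> carrier L; y \<in> carrier L\<rbrakk> \<Longrightarrow> x = y"
  using weak_le_antisym eq_is_equal by auto

lemma le_bottom: "\<lbrakk>x \<sqsubseteq> \<bottom>; x \<in> carrier L\<rbrakk> \<Longrightarrow> x = \<bottom>"
  by (intro antisym) auto

lemma le_meet_iff:
  "\<lbrakk>x \<in> carrier L; y \<in> carrier L; z \<in> carrier L\<rbrakk> \<Longrightarrow> z \<sqsubseteq> x \<sqinter> y \<longleftrightarrow> z \<sqsubseteq> x \<and> z \<sqsubseteq> y"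
  by (meson le_trans meet_closed meet_le meet_left meet_right)

lemma le_compl_contra:
  assumes "q \<in> carrier L" "x \<in> carrier L" "q \<sqsubseteq> x" "q \<sqsubseteq> compl x"
  shows "q = \<bottom>"
proof -
  have "q \<sqsubseteq> x \<sqinter> compl x" using assms by (simp only: le_meet_iff compl_closed simp_thms)
  then show ?thesis using assms by (simp add: meet_compl le_bottom)
qed

lemma bottom_join_bottom: "\<bottom> \<squnion> \<bottom> = \<bottom>"
  by (rule le_bottom) (auto intro: join_le)

lemma meet_top_right: "q \<in> carrier L \<Longrightarrow> q \<sqinter> \<top> = q"
  using le_iff_join[of q \<top>] by simp

lemma meet_join_eq_bottom:
  assumes "q \<in> carrier L" "x \<in> carrier L" "y \<in> carrier L"
  shows "q \<sqinter> (x \<squnion> y) = \<bottom> \<longleftrightarrow> q \<sqinter> x = \<bottom> \<and> q \<sqinter> y = \<bottom>"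
proof
  assume *: "q \<sqinter> (x \<squnion> y) = \<bottom>"
  have "q \<sqinter> x \<sqsubseteq> q \<sqinter> (x \<squnion> y)" "q \<sqinter> y \<sqsubseteq> q \<sqinter> (x \<squnion> y)"
    using assms by (simp_all add: le_meet_iff meet_left join_closed) 
      (meson assms join_closed join_left join_right le_trans meet_closed meet_right)+
  then show "q \<sqinter> x = \<bottom> \<and> q \<sqinter> y = \<bottom>" using * assms by (auto intro: le_bottom)
next
  assume "q \<sqinter> x = \<bottom> \<and> q \<sqinter> y = \<bottom>"
  then show "q \<sqinter> (x \<squnion> y) = \<bottom>"
    using assms by (simp add: meet_join_distrib bottom_join_bottom)
qed

lemma meet_or_meet_compl:
  assumes "q \<in> carrier L" "q \<noteq> \<bottom>" "x \<in> carrier L"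
  shows "q \<sqinter> x \<noteq> \<bottom> \<or> q \<sqinter> compl x \<noteq> \<bottom>"
  using assms meet_join_eq_bottom[of q x "compl x"]
  by (auto simp: compl meet_top_right)

lemma meet_compl_eq_bottom_iff:
  assumes "q \<in> carrier L" "x \<in> carrier L"
  shows "q \<sqinter> compl x = \<bottom> \<longleftrightarrow> q \<sqsubseteq> x"
proof
  assume *: "q \<sqinter> compl x = \<bottom>"
  have "q = q \<sqinter> (x \<squnion> compl x)" using assms by (simp add: compl meet_top_right)
  also have "\<dots> = (q \<sqinter> x) \<squnion> (q \<sqinter> compl x)" using assms by (intro meet_join_distrib compl_closed)
  also have "\<dots> \<sqsubseteq> q \<sqinter> x" using assms * by (auto intro!: join_le)
  finally have "q \<sqsubseteq> q \<sqinter> x" .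
  then show "q \<sqsubseteq> x" using assms by (simp add: le_meet_iff)
next
  assume "q \<sqsubseteq> x"
  then show "q \<sqinter> compl x = \<bottom>"
    using assms le_compl_contra[of "q \<sqinter> compl x" x]
    by (meson compl_closed le_trans meet_closed meet_left meet_right)
qed

lemma meet_eq_bottom_iff:
  assumes "q \<in> carrier L" "x \<in> carrier L"
  shows "q \<sqinter> x = \<bottom> \<longleftrightarrow> q \<sqsubseteq> compl x"
proof
  assume *: "q \<sqinter> x = \<bottom>"
  have "q = q \<sqinter> (x \<squnion> compl x)" using assms by (simp add: compl meet_top_right)
  also have "\<dots> = (q \<sqinter> x) \<squnion> (q \<sqinter> compl x)" using assms by (intro meet_join_distrib compl_closed)
  also have "\<dots> \<sqsubseteq> q \<sqinter> compl x" using assms * by (auto intro!: join_le simp: compl)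
  finally have "q \<sqsubseteq> q \<sqinter> compl x" .
  then show "q \<sqsubseteq> compl x" using assms by (simp add: le_meet_iff compl)
next
  assume "q \<sqsubseteq> compl x"
  then show "q \<sqinter> x = \<bottom>"
    using assms le_compl_contra[of "q \<sqinter> x" x]
    by (meson compl_closed le_trans meet_closed meet_left meet_right)
qed

lemma join_compl_compl_contra:
  assumes "q \<in> carrier L" "x \<in> carrier L" "y \<in> carrier L"
    and "q \<sqsubseteq> x \<squnion> y" "q \<sqsubseteq> compl x" "q \<sqsubseteq> compl y"
  shows "q = \<bottom>"
proof -
  have "q \<sqinter> (x \<squnion> y) = \<bottom>"
    using assms by (simp only: meet_join_eq_bottom) (simp add: meet_eq_bottom_iff)
  then show ?thesis using assms le_iff_join[of q "x \<squnion> y"] by simp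
qed

end

lemma lattice_filter_lower_bound:
  fixes L :: "'b gorder" (structure)
  assumes "boolean_lattice L" and "lattice_filter L F" "finite K" "K \<subseteq> F"
  shows "\<exists>q\<in>F. \<forall>k\<in>K. q \<sqsubseteq> k"
  using assms(3,4)
proof (induction K)
  case empty
  show ?case using assms(2) by (auto simp: lattice_filter_def)
next
  case (insert k K)
  then obtain q where q: "q \<in> F" "\<forall>k\<in>K. q \<sqsubseteq> k" by auto
  interpret boolean_lattice L by fact
  have car: "F \<subseteq> carrier L" and m: "q \<sqinter> k \<in> F"
    using assms(2) q insert.prems by (auto simp: lattice_filter_def)
  show ?case
  proof (intro bexI[OF _ m] ballI)
    fix l assume "l \<in> insert k K"
    have c: "q \<in> carrier L" "k \<in> carrier L" "l \<in> carrier L" "q \<sqinter> k \<in> carrier L"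
      using car q(1) insert.prems m \<open>l \<in> insert k K\<close> by auto
    show "q \<sqinter> k \<sqsubseteq> l"
    proof (cases "l = k")
      case True
      then show ?thesis using meet_right[OF c(1,2)] by simp
    next
      case False
      then have "q \<sqsubseteq> l" using q(2) \<open>l \<in> insert k K\<close> by simp
      then show ?thesis using le_trans[OF meet_left[OF c(1,2)]] c by simp
    qed
  qed
qed

text \<open>Translates consistency from filters to nonzero lower bounds of finite parts, the form
  that \<open>satisfiable\<close> generalizes. The bound is nonzero because a filter containing
  \<bottom> is the whole carrier.\<close>

lemma consistent_lower_bound:
  fixes L :: "'b gorder" (structure)
  assumes "boolean_lattice L" and "consistent L J" "finite K" "K \<subseteq> J"
  shows "\<exists>q\<in>carrier L. q \<noteq> \<bottom> \<and> (\<forall>k\<in>K. q \<sqsubseteq> k)"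
proof -
  interpret boolean_lattice L by fact
  obtain F where F: "lattice_filter L F" "F \<noteq> carrier L" "J \<subseteq> F"
    using assms(2) by (auto simp: consistent_def)
  then have bot: "\<bottom> \<notin> F" by (auto simp: lattice_filter_def)
  obtain q where q: "q \<in> F" "\<forall>k\<in>K. q \<sqsubseteq> k"
    using lattice_filter_lower_bound[OF assms(1) F(1) assms(3)] F(3) assms(4) by blast
  have "q \<in> carrier L" using F(1) q(1) by (auto simp: lattice_filter_def)
  moreover have "q \<noteq> \<bottom>" using q(1) bot by metis
  ultimately show ?thesis using q(2) by (intro bexI conjI)
qed

lemma consistent_singleton:
  fixes L :: "'b gorder" (structure)
  assumes "boolean_lattice L" and "p \<in> carrier L" "p \<noteq> \<bottom>"
  shows "consistent L {p}"
proof -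
  interpret boolean_lattice L by fact
  have "lattice_filter L {r \<in> carrier L. p \<sqsubseteq> r}"
    using assms le_trans[of p] by (auto simp: lattice_filter_def le_meet_iff)
  moreover have "\<bottom> \<notin> {r \<in> carrier L. p \<sqsubseteq> r}" using assms le_bottom by auto
  ultimately show ?thesis using assms(2) bottom_closed unfolding consistent_def by blast
qed

section \<open>The two-element Boolean algebra on two given points\<close>

definition two_lattice :: "'b \<Rightarrow> 'b \<Rightarrow> 'b gorder" where
  "two_lattice b t = \<lparr>carrier = {b, t}, eq = (=), le = (\<lambda>x y. x = b \<or> y = t)\<rparr>"

context
  fixes b t :: 'b
  assumes neq: "b \<noteq> t"
begin

lemma two_lattice_bounds:
  shows two_lattice_bottom: "\<bottom>\<^bsub>two_lattice b t\<^esub> = b"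
    and two_lattice_top: "\<top>\<^bsub>two_lattice b t\<^esub> = t"
  using neq unfolding bottom_def top_def least_def greatest_def two_lattice_def by auto

lemma two_lattice_total_order: "total_order (two_lattice b t)"
  by unfold_locales (use neq in \<open>auto simp: two_lattice_def\<close>)

lemma two_lattice_lattice: "lattice (two_lattice b t)"
proof -
  interpret total_order "two_lattice b t" by (rule two_lattice_total_order)
  show ?thesis ..
qed

lemma two_lattice_ops:
  assumes "x \<in> {b, t}" "y \<in> {b, t}"
  shows two_lattice_meet: "x \<sqinter>\<^bsub>two_lattice b t\<^esub> y = (if x = b then b else y)"
    and two_lattice_join: "x \<squnion>\<^bsub>two_lattice b t\<^esub> y = (if x = t then t else y)"
proof -
  interpret lattice "two_lattice b t" by (rule two_lattice_lattice)
  have c: "carrier (two_lattice b t) = {b, t}" by (simp add: two_lattice_def)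
  have l: "le (two_lattice b t) u v \<longleftrightarrow> u = b \<or> v = t" for u v by (simp add: two_lattice_def)
  show "x \<sqinter>\<^bsub>two_lattice b t\<^esub> y = (if x = b then b else y)"
    using assms le_iff_join[of x y] le_iff_join[of y x] neq
    unfolding c l by (auto simp: meet_comm)
  show "x \<squnion>\<^bsub>two_lattice b t\<^esub> y = (if x = t then t else y)"
    using assms le_iff_meet[of x y] le_iff_meet[of y x] neq
    unfolding c l by (auto simp: join_comm)
qed

lemma two_lattice_boolean: "boolean_lattice (two_lattice b t)"
proof -
  interpret lattice "two_lattice b t" by (rule two_lattice_lattice)
  have c: "carrier (two_lattice b t) = {b, t}" by (simp add: two_lattice_def)
  show ?thesis
  proof unfold_locales
    show "\<exists>x. least (two_lattice b t) x (carrier (two_lattice b t))"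
      by (rule exI[of _ b]) (simp add: two_lattice_def least_def)
    show "\<exists>x. greatest (two_lattice b t) x (carrier (two_lattice b t))"
      by (rule exI[of _ t]) (simp add: two_lattice_def greatest_def)
  next
    fix x y z
    assume "x \<in> carrier (two_lattice b t)" "y \<in> carrier (two_lattice b t)"
      "z \<in> carrier (two_lattice b t)"
    then have xyz: "x \<in> {b, t}" "y \<in> {b, t}" "z \<in> {b, t}" by (simp_all only: c)
    have *: "(if y = t then t else z) \<in> {b, t}" "(if x = b then b else y) \<in> {b, t}"
      "(if x = b then b else z) \<in> {b, t}" using xyz by auto
    show "x \<sqinter>\<^bsub>two_lattice b t\<^esub> (y \<squnion>\<^bsub>two_lattice b t\<^esub> z) =
        (x \<sqinter>\<^bsub>two_lattice b t\<^esub> y) \<squnion>\<^bsub>two_lattice b t\<^esub> (x \<sqinter>\<^bsub>two_lattice b t\<^esub> z)"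
      using xyz neq by (simp only: two_lattice_ops *) auto
  next
    fix x assume "x \<in> carrier (two_lattice b t)"
    then have x: "x \<in> {b, t}" by (simp only: c)
    define y where "y = (if x = b then t else b)"
    have y: "y \<in> {b, t}" by (simp add: y_def)
    have "x \<sqinter>\<^bsub>two_lattice b t\<^esub> y = b" "x \<squnion>\<^bsub>two_lattice b t\<^esub> y = t"
      using x neq by (simp_all only: two_lattice_ops[OF x y]) (auto simp: y_def)
    then show "\<exists>y\<in>carrier (two_lattice b t). x \<sqinter>\<^bsub>two_lattice b t\<^esub> y = \<bottom>\<^bsub>two_lattice b t\<^esub> \<and>
        x \<squnion>\<^bsub>two_lattice b t\<^esub> y = \<top>\<^bsub>two_lattice b t\<^esub>"
      using y by (intro bexI[of _ y]) (simp_all only: two_lattice_bounds c simp_thms)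
  qed
qed

end

text \<open>A prime filter, given here by its membership predicate \<open>Q\<close>, is the same as
  a homomorphism to 2. This yields P4 for substitutions into the empty set, with truth in the model
  as \<open>Q\<close>.\<close>

lemma boolean_hom_two_lattice:
  fixes M :: "'c gorder"
  assumes neq: "b \<noteq> t" and M: "boolean_lattice M"
    and bot: "\<not> Q \<bottom>\<^bsub>M\<^esub>" and top: "Q \<top>\<^bsub>M\<^esub>"
    and meet: "\<And>p q. \<lbrakk>p \<in> carrier M; q \<in> carrier M\<rbrakk> \<Longrightarrow> Q (p \<sqinter>\<^bsub>M\<^esub> q) \<longleftrightarrow> Q p \<and> Q q"
    and join: "\<And>p q. \<lbrakk>p \<in> carrier M; q \<in> carrier M\<rbrakk> \<Longrightarrow> Q (p \<squnion>\<^bsub>M\<^esub> q) \<longleftrightarrow> Q p \<or> Q q"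
  shows "boolean_hom M (two_lattice b t) (\<lambda>p. if Q p then t else b)"
proof -
  let ?N = "two_lattice b t"
  define h where "h = (\<lambda>p. if Q p then t else b)"
  have h: "h p \<in> {b, t}" for p by (simp add: h_def)
  have "lattice M" using M by (simp add: boolean_lattice_def bounded_lattice_def)
  moreover have "lattice ?N" using neq by (rule two_lattice_lattice)
  moreover have "h \<in> carrier M \<rightarrow> carrier ?N" by (simp add: h_def two_lattice_def)
  moreover have "h (x \<sqinter>\<^bsub>M\<^esub> y) = h x \<sqinter>\<^bsub>?N\<^esub> h y" if "x \<in> carrier M" "y \<in> carrier M" for x y
    unfolding two_lattice_meet[OF neq h h] by (simp add: h_def meet[OF that] neq)
  moreover have "h (x \<squnion>\<^bsub>M\<^esub> y) = h x \<squnion>\<^bsub>?N\<^esub> h y" if "x \<in> carrier M" "y \<in> carrier M" for x y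
    unfolding two_lattice_join[OF neq h h] by (simp add: h_def join[OF that] neq[symmetric])
  moreover have "h \<bottom>\<^bsub>M\<^esub> = b" "h \<top>\<^bsub>M\<^esub> = t" using bot top by (simp_all add: h_def)
  ultimately have "boolean_hom M ?N h"
    unfolding boolean_hom_def meet_pres_def join_pres_def two_lattice_bounds[OF neq] by blast
  then show ?thesis by (simp only: h_def)
qed

text \<open>In 2 an infimum is a conjunction. This turns the infimum of M2 into the quantifier over
  the domain that \<open>holds_univ\<close> supplies.\<close>

lemma two_lattice_glb:
  assumes "b \<noteq> t"
  shows "is_glb (two_lattice b t) (if \<forall>d\<in>D. Q d then t else b) ((\<lambda>d. if Q d then t else b) ` D)"
proof (cases "\<forall>d\<in>D. Q d")
  case True
  then show ?thesis by (auto simp: two_lattice_def greatest_def Lower_def)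
next
  case False
  then obtain d where d: "d \<in> D" "\<not> Q d" by blast
  then have "b \<in> (\<lambda>d. if Q d then t else b) ` D" by force
  then show ?thesis using False assms by (auto simp: two_lattice_def greatest_def Lower_def)
qed

section \<open>Substitution and quantification with fresh variables\<close>

locale locally_finite_algebra = quantifier_theory "{X}" A
  for X :: "'v set" and A :: "('v, 'a, 'b) qtheory" +
  assumes infinite_vars: "infinite X" and locally_finite: "locally_finite {X} A"
begin

abbreviation L where "L \<equiv> forms A X"
abbreviation P where "P \<equiv> carrier (forms A X)"
abbreviation T where "T \<equiv> terms A X"
abbreviation tsub where "tsub \<equiv> tsubst A X X"
abbreviation psub where "psub \<equiv> psubst A X X"
abbreviation Substs where "Substs \<equiv> X \<rightarrow>\<^sub>E T"

sublocale L: boolean_lattice "forms A X"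
  by (simp add: forms_boolean)

lemma vars_nonempty: "X \<noteq> {}"
  using infinite_vars by auto

lemma var_Substs: "var A X \<in> Substs"
  by (simp add: var_type)

lemma var_closed: "x \<in> X \<Longrightarrow> var A X x \<in> T"
  using var_Substs by auto

lemma tsub_closed: "\<lbrakk>a \<in> T; \<sigma> \<in> Substs\<rbrakk> \<Longrightarrow> tsub a \<sigma> \<in> T"
  by (simp add: tsubst_type vars_nonempty)

lemma psub_closed: "\<lbrakk>p \<in> P; \<sigma> \<in> Substs\<rbrakk> \<Longrightarrow> psub p \<sigma> \<in> P"
  by (simp add: psubst_type vars_nonempty)

lemma univ_closed: "\<lbrakk>p \<in> P; x \<in> X\<rbrakk> \<Longrightarrow> univ A X x p \<in> P"
  by (simp add: univ_type)

lemma upd_Substs: "\<lbrakk>\<sigma> \<in> Substs; x \<in> X; t \<in> T\<rbrakk> \<Longrightarrow> \<sigma>(x := t) \<in> Substs"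
  by (auto simp: PiE_iff extensional_def)

lemma psub_hom: "\<sigma> \<in> Substs \<Longrightarrow> boolean_hom L L (\<lambda>p. psub p \<sigma>)"
  by (simp add: P4 vars_nonempty)

lemma psub_mono:
  "\<lbrakk>\<sigma> \<in> Substs; p \<in> P; q \<in> P; p \<sqsubseteq>\<^bsub>L\<^esub> q\<rbrakk> \<Longrightarrow> psub p \<sigma> \<sqsubseteq>\<^bsub>L\<^esub> psub q \<sigma>"
  using meet_pres_isotone[of "\<lambda>p. psub p \<sigma>" L L] psub_hom[of \<sigma>]
  by (simp add: boolean_hom_def isotone_def)

text \<open>Q1 makes \<forall>x preserve binary meets, and p \<le> q says that p \<sqinter> q =
  p.\<close>

lemma univ_mono:
  assumes "x \<in> X" "p \<in> P" "q \<in> P" "p \<sqsubseteq>\<^bsub>L\<^esub> q"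
  shows "univ A X x p \<sqsubseteq>\<^bsub>L\<^esub> univ A X x q"
proof -
  have "p \<sqinter>\<^bsub>L\<^esub> q = p" using L.le_iff_join[of p q] assms(2-4) by metis
  then have "univ A X x p = univ A X x p \<sqinter>\<^bsub>L\<^esub> univ A X x q"
    using Q1[OF _ assms(1-3)] by (metis singletonI)
  then show ?thesis
    using L.le_iff_join[of "univ A X x p" "univ A X x q"] assms(1-3) univ_closed by blast
qed

lemma term_support_exists: "a \<in> T \<Longrightarrow> \<exists>U. finite U \<and> term_support {X} A X a U"
  using locally_finite vars_nonempty unfolding locally_finite_def by blast

lemma form_support_exists: "p \<in> P \<Longrightarrow> \<exists>U. finite U \<and> form_support {X} A X p U"
  using locally_finite vars_nonempty unfolding locally_finite_def by blast

lemma term_supportD: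
  "\<lbrakk>term_support {X} A X a U; \<sigma> \<in> Substs; \<tau> \<in> Substs; \<And>x. x \<in> U \<Longrightarrow> \<sigma> x = \<tau> x\<rbrakk>
    \<Longrightarrow> tsub a \<sigma> = tsub a \<tau>"
  unfolding term_support_def by blast

lemma form_supportD:
  "\<lbrakk>form_support {X} A X p U; \<sigma> \<in> Substs; \<tau> \<in> Substs; \<And>x. x \<in> U \<Longrightarrow> \<sigma> x = \<tau> x\<rbrakk>
    \<Longrightarrow> psub p \<sigma> = psub p \<tau>"
  unfolding form_support_def by blast

text \<open>Local finiteness leaves a variable \<open>y\<close> outside the supports of
  \<open>q\<close> and of all terms in \<open>N\<close>; any other variable serves as
  \<open>z\<close>. Freshness is expressed by invariance under [z/y] because P5 and Q3 ask for it in
  this form.\<close>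

lemma fresh_var:
  assumes "finite N" "N \<subseteq> T" "q \<in> P"
  obtains y z where "y \<in> X" "z \<in> X" "y \<noteq> z"
    and "\<And>a. a \<in> N \<Longrightarrow> tsub a ((var A X)(y := var A X z)) = a"
    and "psub q ((var A X)(y := var A X z)) = q"
proof -
  have "\<forall>a\<in>N. \<exists>U. finite U \<and> term_support {X} A X a U"
    using term_support_exists assms(2) by blast
  then obtain s where s: "\<And>a. a \<in> N \<Longrightarrow> finite (s a) \<and> term_support {X} A X a (s a)"
    by metis
  obtain U where U: "finite U" "form_support {X} A X q U"
    using form_support_exists assms(3) by blast
  have "finite (U \<union> (\<Union>a\<in>N. s a))" using U(1) s assms(1) by auto
  then have "infinite (X - (U \<union> (\<Union>a\<in>N. s a)))" using infinite_vars by (rule Diff_infinite_finite)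
  then obtain y where "y \<in> X - (U \<union> (\<Union>a\<in>N. s a))" using infinite_imp_nonempty by blast
  then have y: "y \<in> X" "y \<notin> U" "\<And>a. a \<in> N \<Longrightarrow> y \<notin> s a" by auto
  have "infinite (X - {y})" using infinite_vars by simp
  then obtain z where "z \<in> X - {y}" using infinite_imp_nonempty by blast
  then have z: "z \<in> X" "z \<noteq> y" by auto
  have sub: "(var A X)(y := var A X z) \<in> Substs"
    using y z by (intro upd_Substs var_Substs var_closed)
  show thesis
  proof
    show "tsub a ((var A X)(y := var A X z)) = a" if "a \<in> N" for a
    proof -
      have "tsub a ((var A X)(y := var A X z)) = tsub a (var A X)"
        by (rule term_supportD[OF _ sub var_Substs]) (use s[OF that] y(3)[OF that] in auto)
      also have "\<dots> = a" using that assms(2) by (auto intro!: P1_term vars_nonempty)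
      finally show ?thesis .
    qed
    have "psub q ((var A X)(y := var A X z)) = psub q (var A X)"
      by (rule form_supportD[OF U(2) sub var_Substs]) (use y in auto)
    also have "\<dots> = q" using assms(3) by (auto intro!: P1_form vars_nonempty)
    finally show "psub q ((var A X)(y := var A X z)) = q" .
  qed (use y z in auto)
qed

text \<open>P5 renames the bound variable only for substitutions that avoid the new one. Local
  finiteness extends this to all substitutions. One \<open>y\<close> serves finitely many of them,
  so that two can be compared under the same quantifier (\<open>univ_psub_cong\<close>), and it
  leaves \<open>q\<close> fixed under \<forall>y, as \<open>henk_step\<close> requires.\<close>

lemma univ_psub:
  assumes p: "p \<in> P" and x: "x \<in> X" and \<Sigma>: "finite \<Sigma>" "\<Sigma> \<subseteq> Substs" and q: "q \<in> P"
  obtains y where "y \<in> X" "univ A X y q = q"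
    and "\<And>\<sigma>. \<sigma> \<in> \<Sigma> \<Longrightarrow> psub (univ A X x p) \<sigma> = univ A X y (psub p (\<sigma>(x := var A X y)))"
proof -
  obtain U U' where U: "finite U" "form_support {X} A X p U"
    and U': "finite U'" "form_support {X} A X (univ A X x p) U'"
    using form_support_exists[OF p] form_support_exists[OF univ_closed[OF p x]] by blast
  have UX: "U \<subseteq> X" "U' \<subseteq> X" using U U' by (auto simp: form_support_def)
  \<comment> \<open>P5 needs a variable that occurs in no value of the substitution, so each substitution is
      first changed off the supports to one with finitely many values.\<close>
  define cut where "cut \<sigma> = (\<lambda>u\<in>X. if u \<in> U \<union> U' then \<sigma> u else var A X x)" for \<sigma> :: "'v \<Rightarrow> 'a"
  have cut: "cut \<sigma> \<in> Substs" if "\<sigma> \<in> Substs" for \<sigma>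
    using that x var_closed by (auto simp: cut_def)
  define N where "N = insert (var A X x) (\<Union>\<sigma>\<in>\<Sigma>. \<sigma> ` (U \<union> U'))"
  have "finite N" using \<Sigma> U U' by (auto simp: N_def)
  moreover have "N \<subseteq> T" using \<Sigma> UX x var_closed by (auto simp: N_def)
  ultimately obtain y z where yz: "y \<in> X" "z \<in> X" "y \<noteq> z"
    and fresh: "\<And>a. a \<in> N \<Longrightarrow> tsub a ((var A X)(y := var A X z)) = a"
    and q': "psub q ((var A X)(y := var A X z)) = q"
    using fresh_var[OF _ _ q] by blast
  show thesis
  proof
    show "y \<in> X" by fact
    show "univ A X y q = q" using yz q q' by (intro Q3[of X y q z]) auto
    fix \<sigma> assume s: "\<sigma> \<in> \<Sigma>"
    then have s': "\<sigma> \<in> Substs" using \<Sigma> by auto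
    have "cut \<sigma> u \<in> N" if "u \<in> X" for u using s that by (auto simp: cut_def N_def)
    then have "scomp A X X X (cut \<sigma>) ((var A X)(y := var A X z)) = cut \<sigma>"
      using fresh by (intro ext) (simp add: scomp_def cut_def)
    then have "psub (univ A X x p) (cut \<sigma>) = univ A X y (psub p ((cut \<sigma>)(x := var A X y)))"
      using x p cut[OF s'] yz by (intro P5[where z = z]) auto
    moreover have "psub (univ A X x p) (cut \<sigma>) = psub (univ A X x p) \<sigma>"
    proof (rule form_supportD[OF U'(2) cut[OF s'] s'])
      show "cut \<sigma> u = \<sigma> u" if "u \<in> U'" for u using that UX by (auto simp: cut_def)
    qed
    moreover have "psub p ((cut \<sigma>)(x := var A X y)) = psub p (\<sigma>(x := var A X y))"
    proof (rule form_supportD[OF U(2)])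
      show "(cut \<sigma>)(x := var A X y) \<in> Substs" "\<sigma>(x := var A X y) \<in> Substs"
        using s' x yz cut[OF s'] by (simp_all only: upd_Substs var_closed)
      show "((cut \<sigma>)(x := var A X y)) u = (\<sigma>(x := var A X y)) u" if "u \<in> U" for u
        using that UX by (auto simp: cut_def)
    qed
    ultimately show "psub (univ A X x p) \<sigma> = univ A X y (psub p (\<sigma>(x := var A X y)))"
      by simp
  qed
qed

text \<open>The value at the bound variable has no influence: after renaming with a common
  \<open>y\<close>, both sides quantify the same formula, since the updated substitutions agree on
  all of \<open>U\<close>.\<close>

lemma univ_psub_cong:
  assumes "p \<in> P" "x \<in> X" "form_support {X} A X p U" "\<sigma> \<in> Substs" "\<tau> \<in> Substs"
    and eq: "\<And>u. u \<in> U \<Longrightarrow> u \<noteq> x \<Longrightarrow> \<sigma> u = \<tau> u"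
  shows "psub (univ A X x p) \<sigma> = psub (univ A X x p) \<tau>"
proof -
  obtain y where y: "y \<in> X" and
    *: "\<And>\<rho>. \<rho> \<in> {\<sigma>, \<tau>} \<Longrightarrow> psub (univ A X x p) \<rho> = univ A X y (psub p (\<rho>(x := var A X y)))"
    by (rule univ_psub[OF assms(1,2), of "{\<sigma>, \<tau>}" p]) (use assms in auto)
  have "psub p (\<sigma>(x := var A X y)) = psub p (\<tau>(x := var A X y))"
  proof (rule form_supportD[OF assms(3)])
    show "\<sigma>(x := var A X y) \<in> Substs" "\<tau>(x := var A X y) \<in> Substs"
      using assms(2,4,5) y by (simp_all only: upd_Substs var_closed)
    show "(\<sigma>(x := var A X y)) u = (\<tau>(x := var A X y)) u" if "u \<in> U" for u
      using eq[OF that] by simp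
  qed
  then show ?thesis using *[of \<sigma>] *[of \<tau>] by simp
qed

text \<open>Since \<forall>x.p does not see the value of \<sigma> at \<open>x\<close>, that value
  may first be set to \<open>t\<close>; then Q2 is carried along by the substitution.\<close>

lemma univ_psub_le:
  assumes "p \<in> P" "x \<in> X" "\<sigma> \<in> Substs" "t \<in> T"
  shows "psub (univ A X x p) \<sigma> \<sqsubseteq>\<^bsub>L\<^esub> psub p (\<sigma>(x := t))"
proof -
  have up: "\<sigma>(x := t) \<in> Substs" using assms by (intro upd_Substs)
  obtain U where "form_support {X} A X p U" using form_support_exists assms(1) by blast
  then have "psub (univ A X x p) \<sigma> = psub (univ A X x p) (\<sigma>(x := t))"
    by (rule univ_psub_cong[OF assms(1,2) _ assms(3) up]) simp_all
  also have "\<dots> \<sqsubseteq>\<^bsub>L\<^esub> psub p (\<sigma>(x := t))"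
    using assms by (intro psub_mono[OF up] Q2 univ_closed) auto
  finally show ?thesis .
qed

text \<open>In a one-element algebra every formula is closed, against the nontriviality convention.
  The inequality lets \<bottom> and \<top> of \<open>L\<close> serve as the two truth values of the
  model.\<close>

lemma bottom_neq_top: "\<bottom>\<^bsub>L\<^esub> \<noteq> \<top>\<^bsub>L\<^esub>"
proof
  assume *: "\<bottom>\<^bsub>L\<^esub> = \<top>\<^bsub>L\<^esub>"
  have "p = \<bottom>\<^bsub>L\<^esub>" if "p \<in> P" for p
    using that L.top_higher[of p] by (intro L.le_bottom) (auto simp: *)
  then have "form_support {X} A X p {}" if "p \<in> P" for p
    using that psub_closed unfolding form_support_def by (metis empty_subsetI singletonD)
  then show False using nontrivial by auto
qed

text \<open>If two variables had the same image, P3 would make all terms equal; then there would be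
  at most one substitution and every formula would be closed. Injectivity lets a witness reveal its
  quantified variable.\<close>

lemma inj_var: "inj_on (var A X) X"
proof (rule inj_onI, rule ccontr)
  fix x y assume xy: "x \<in> X" "y \<in> X" "var A X x = var A X y" "x \<noteq> y"
  have "a = b" if "a \<in> T" "b \<in> T" for a b
  proof -
    define \<sigma> where "\<sigma> = (\<lambda>u\<in>X. if u = x then a else b)"
    have "\<sigma> \<in> Substs" using that by (auto simp: \<sigma>_def)
    then have "\<sigma> x = \<sigma> y" using P3[of X x X \<sigma>] P3[of X y X \<sigma>] xy by simp
    then show ?thesis using xy by (auto simp: \<sigma>_def)
  qed
  then have "\<sigma> = \<tau>" if "\<sigma> \<in> Substs" "\<tau> \<in> Substs" for \<sigma> \<tau>
    using that by (intro PiE_ext[of \<sigma> X "\<lambda>_. T"]) (auto simp: PiE_iff)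
  then have "form_support {X} A X p {}" for p
    unfolding form_support_def by (metis empty_subsetI singletonD)
  then show False using nontrivial by auto
qed

end

section \<open>Terms with parameters\<close>

text \<open>A self-delimiting code: every entry is preceded by its length in unary, with
  \<open>Inr undefined\<close> as end mark. The control symbols are one letter from each summand, so
  nothing is assumed about the size of \<open>'a\<close> and \<open>'b\<close>.\<close>

definition enc :: "('a + 'b) list list \<Rightarrow> ('a + 'b) list" where
  "enc vs = concat (map (\<lambda>v. replicate (length v) (Inl undefined) @ Inr undefined # v) vs)"

lemma replicate_append_Cons_eq:
  assumes "replicate m a @ b # xs = replicate n a @ b # ys" "a \<noteq> b"
  shows "m = n \<and> xs = ys"
  using assms(1)
proof (induction m arbitrary: n)
  case 0
  then show ?case using assms(2) by (cases n) auto
next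
  case (Suc m)
  then show ?case using assms(2) by (cases n) auto
qed

lemma enc_eq_iff: "enc vs = enc ws \<longleftrightarrow> vs = ws"
proof
  show "enc vs = enc ws \<Longrightarrow> vs = ws"
  proof (induction vs arbitrary: ws)
    case Nil
    then show ?case by (cases ws) (auto simp: enc_def)
  next
    case (Cons v vs)
    then obtain w ws' where ws: "ws = w # ws'" by (cases ws) (auto simp: enc_def)
    have "replicate (length v) (Inl undefined) @ Inr undefined # (v @ enc vs) =
        replicate (length w) (Inl undefined) @ Inr undefined # (w @ enc ws')"
      using Cons.prems by (simp add: ws enc_def)
    from replicate_append_Cons_eq[OF this]
    have "length v = length w" "v @ enc vs = w @ enc ws'" by simp_all
    then show ?case using Cons.IH[of ws'] by (simp add: ws)
  qed
qed simp

text \<open>Strictness comes from the end mark. Through \<open>wit\<close> it makes a witness longer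
  than the parameters in its data.\<close>

lemma length_enc: "v \<in> set vs \<Longrightarrow> length v < length (enc vs)"
  by (induction vs) (auto simp: enc_def)

context locally_finite_algebra
begin

text \<open>
  The parameters are the lists over \<open>'a + 'b\<close>, and a formula with parameters is the function that
  maps every assignment of terms to the parameters to the resulting element of \<open>P\<close>.
\<close>

definition Asg :: "(('a + 'b) list \<Rightarrow> 'a) set" where
  "Asg = {h. \<forall>v. h v \<in> T}"

definition depends :: "('a + 'b) list set \<Rightarrow> ((('a + 'b) list \<Rightarrow> 'a) \<Rightarrow> 'c) \<Rightarrow> bool" where
  "depends F g \<longleftrightarrow> (\<forall>h\<in>Asg. \<forall>h'\<in>Asg. (\<forall>v\<in>F. h v = h' v) \<longrightarrow> g h = g h')"

definition act :: "(('a + 'b) list \<Rightarrow> 'a) \<Rightarrow> ('v \<Rightarrow> 'a) \<Rightarrow> ('a + 'b) list \<Rightarrow> 'a" where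
  "act h r = (\<lambda>v. tsub (h v) r)"

text \<open>
  Terms with parameters, as functions of the assignment. Commuting with substitutions makes such
  a function determined by its value at a single generic assignment.
\<close>

definition Dom :: "((('a + 'b) list \<Rightarrow> 'a) \<Rightarrow> 'a) set" where
  "Dom = {d \<in> Asg \<rightarrow>\<^sub>E T. (\<forall>h\<in>Asg. \<forall>r\<in>Substs. d (act h r) = tsub (d h) r) \<and>
     (\<exists>vs. depends (set vs) d)}"

definition inst :: "('v \<Rightarrow> (('a + 'b) list \<Rightarrow> 'a) \<Rightarrow> 'a) \<Rightarrow> (('a + 'b) list \<Rightarrow> 'a) \<Rightarrow> 'v \<Rightarrow> 'a" where
  "inst \<sigma> h = (\<lambda>x\<in>X. \<sigma> x h)"

lemma Asg_closed: "h \<in> Asg \<Longrightarrow> h v \<in> T"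
  by (simp add: Asg_def)

lemma Asg_upd: "\<lbrakk>h \<in> Asg; t \<in> T\<rbrakk> \<Longrightarrow> h(v := t) \<in> Asg"
  by (simp add: Asg_def)

lemma act_Asg: "\<lbrakk>h \<in> Asg; r \<in> Substs\<rbrakk> \<Longrightarrow> act h r \<in> Asg"
  by (simp add: Asg_def act_def tsub_closed)

lemma dependsD:
  "\<lbrakk>depends F g; h \<in> Asg; h' \<in> Asg; \<And>v. v \<in> F \<Longrightarrow> h v = h' v\<rbrakk> \<Longrightarrow> g h = g h'"
  unfolding depends_def by blast

lemma Dom_closed: "\<lbrakk>d \<in> Dom; h \<in> Asg\<rbrakk> \<Longrightarrow> d h \<in> T"
  by (auto simp: Dom_def)

lemma Dom_act: "\<lbrakk>d \<in> Dom; h \<in> Asg; r \<in> Substs\<rbrakk> \<Longrightarrow> d (act h r) = tsub (d h) r"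
  by (simp add: Dom_def)

lemma inst_Substs: "\<lbrakk>\<sigma> \<in> X \<rightarrow> Dom; h \<in> Asg\<rbrakk> \<Longrightarrow> inst \<sigma> h \<in> Substs"
  by (simp add: inst_def Pi_iff Dom_closed)

text \<open>This is the parameter \<open>v\<close> seen as a term. Henkin witnesses and the images
  of the variables in \<open>X\<close> enter the domain in this form.\<close>

lemma point_Dom: "(\<lambda>h\<in>Asg. h v) \<in> Dom"
proof -
  have "\<exists>vs. depends (set vs) (\<lambda>h\<in>Asg. h v)"
    by (rule exI[of _ "[v]"]) (simp add: depends_def)
  moreover have "(\<lambda>h\<in>Asg. h v) \<in> Asg \<rightarrow>\<^sub>E T" by (simp add: Asg_closed)
  moreover have "(\<lambda>h\<in>Asg. h v) (act h r) = tsub ((\<lambda>h\<in>Asg. h v) h) r"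
    if "h \<in> Asg" "r \<in> Substs" for h r
    using that by (simp add: act_Asg) (simp add: act_def)
  ultimately show ?thesis unfolding Dom_def by blast
qed

definition params :: "((('a + 'b) list \<Rightarrow> 'a) \<Rightarrow> 'a) \<Rightarrow> ('a + 'b) list list" where
  "params d = (SOME vs. depends (set vs) d)"

lemma depends_params: "d \<in> Dom \<Longrightarrow> depends (set (params d)) d"
  unfolding params_def by (rule someI_ex) (simp add: Dom_def)

text \<open>Lets domain elements be substituted into terms of the algebra. Finite dependence
  survives because \<open>b\<close> has a finite support and each term put there has a finite
  parameter list; commutation with substitutions is P2.\<close>

lemma tsub_inst_Dom:
  assumes b: "b \<in> T" and \<sigma>: "\<sigma> \<in> X \<rightarrow> Dom"
  shows "(\<lambda>h\<in>Asg. tsub b (inst \<sigma> h)) \<in> Dom"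
proof -
  obtain U where U: "finite U" "term_support {X} A X b U" using term_support_exists[OF b] by blast
  then have UX: "U \<subseteq> X" by (simp add: term_support_def)
  obtain us where us: "set us = U" using U(1) finite_list by blast
  define vs where "vs = concat (map (\<lambda>u. params (\<sigma> u)) us)"
  have "depends (set vs) (\<lambda>h\<in>Asg. tsub b (inst \<sigma> h))"
    unfolding depends_def
  proof (intro ballI impI)
    fix h h' assume h: "h \<in> Asg" "h' \<in> Asg" and eq: "\<forall>v\<in>set vs. h v = h' v"
    have "tsub b (inst \<sigma> h) = tsub b (inst \<sigma> h')"
    proof (rule term_supportD[OF U(2) inst_Substs[OF \<sigma> h(1)] inst_Substs[OF \<sigma> h(2)]])
      fix u assume u: "u \<in> U"
      then have "\<sigma> u \<in> Dom" using UX \<sigma> by auto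
      from depends_params[OF this] have "\<sigma> u h = \<sigma> u h'"
        by (rule dependsD[OF _ h]) (use eq u us in \<open>auto simp: vs_def\<close>)
      then show "inst \<sigma> h u = inst \<sigma> h' u" by (simp add: inst_def)
    qed
    then show "(\<lambda>h\<in>Asg. tsub b (inst \<sigma> h)) h = (\<lambda>h\<in>Asg. tsub b (inst \<sigma> h)) h'"
      using h by simp
  qed
  moreover have "tsub b (inst \<sigma> (act h r)) = tsub (tsub b (inst \<sigma> h)) r"
    if h: "h \<in> Asg" and r: "r \<in> Substs" for h r
  proof -
    have "inst \<sigma> (act h r) = scomp A X X X (inst \<sigma> h) r"
      using \<sigma> h r by (intro ext) (simp add: inst_def scomp_def Dom_act Pi_iff)
    then show ?thesis
      using P2_term[of X X X b "inst \<sigma> h" r] b r inst_Substs[OF \<sigma> h] vars_nonempty by simp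
  qed
  moreover have "(\<lambda>h\<in>Asg. tsub b (inst \<sigma> h)) \<in> Asg \<rightarrow>\<^sub>E T"
    using b \<sigma> by (auto intro!: tsub_closed inst_Substs)
  ultimately show ?thesis unfolding Dom_def by (auto simp: act_Asg)
qed

section \<open>Generic assignments and codes of terms with parameters\<close>

definition some_vars :: "nat \<Rightarrow> 'v" where
  "some_vars = (SOME f. inj f \<and> range f \<subseteq> X)"

lemma some_vars: shows inj_some_vars: "inj some_vars" and some_vars_closed: "some_vars i \<in> X"
proof -
  have "\<exists>f :: nat \<Rightarrow> 'v. inj f \<and> range f \<subseteq> X"
    using infinite_vars by (rule infinite_countable_subset)
  from someI_ex[OF this] show "inj some_vars" "some_vars i \<in> X"
    unfolding some_vars_def by auto
qed

text \<open>Distinct members of \<open>vs\<close> receive distinct variables, so a substitution can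
  move the listed parameters independently. Parameters outside \<open>vs\<close> get an unspecified
  variable.\<close>

definition generic :: "('a + 'b) list list \<Rightarrow> ('a + 'b) list \<Rightarrow> 'a" where
  "generic vs v = var A X (some_vars (SOME i. i < length vs \<and> vs ! i = v))"

lemma generic_Asg: "generic vs \<in> Asg"
  by (simp add: Asg_def generic_def var_closed some_vars_closed)

text \<open>On \<open>vs\<close> the generic assignment is free: sending the variable of each listed
  parameter to its value under \<open>h\<close> recovers \<open>h\<close>.\<close>

lemma generic_act:
  assumes h: "h \<in> Asg"
  obtains r where "r \<in> Substs" "\<And>v. v \<in> set vs \<Longrightarrow> act (generic vs) r v = h v"
proof
  define r where "r = (\<lambda>x\<in>X. h (vs ! inv_into UNIV some_vars x))"
  show r: "r \<in> Substs" using h by (auto simp: r_def Asg_closed)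
  fix v assume "v \<in> set vs"
  then have "\<exists>i. i < length vs \<and> vs ! i = v" by (simp add: in_set_conv_nth)
  from someI_ex[OF this]
  have *: "vs ! (SOME i. i < length vs \<and> vs ! i = v) = v" by blast
  have "act (generic vs) r v = r (some_vars (SOME i. i < length vs \<and> vs ! i = v))"
    unfolding act_def generic_def by (rule P3) (use r some_vars_closed in auto)
  also have "\<dots> = h v"
    by (simp add: r_def some_vars_closed inv_f_f[OF inj_some_vars] *)
  finally show "act (generic vs) r v = h v" .
qed

text \<open>A code has the type of a parameter, which lets it enter witnesses, and it contains every
  listed parameter, which makes it longer than each of them.\<close>

definition code :: "((('a + 'b) list \<Rightarrow> 'a) \<Rightarrow> 'a) \<Rightarrow> ('a + 'b) list" where
  "code d = Inl (d (generic (params d))) # enc (params d)"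

lemma length_code: "v \<in> set (params d) \<Longrightarrow> length v < length (code d)"
  using length_enc[of v "params d"] by (simp add: code_def)

text \<open>Every assignment agrees on the listed parameters with a substitution instance of the
  generic one, so commutation with substitutions transports the recorded value to all values of
  \<open>d\<close>.\<close>

lemma inj_code: "inj_on code Dom"
proof (rule inj_onI)
  fix d e assume d: "d \<in> Dom" and e: "e \<in> Dom" and "code d = code e"
  then have p: "params d = params e" and eq: "d (generic (params d)) = e (generic (params d))"
    by (auto simp: code_def enc_eq_iff)
  show "d = e"
  proof (rule PiE_ext)
    show "d \<in> Asg \<rightarrow>\<^sub>E T" "e \<in> Asg \<rightarrow>\<^sub>E T" using d e by (auto simp: Dom_def)
    fix h assume h: "h \<in> Asg"
    obtain r where r: "r \<in> Substs"
      "\<And>v. v \<in> set (params d) \<Longrightarrow> act (generic (params d)) r v = h v"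
      using generic_act[OF h] by blast
    have a: "act (generic (params d)) r \<in> Asg" using r(1) generic_Asg by (intro act_Asg)
    have "d h = d (act (generic (params d)) r)"
      by (rule dependsD[OF depends_params[OF d] h a]) (simp add: r(2))
    also have "\<dots> = e (act (generic (params d)) r)"
      using Dom_act[OF d generic_Asg r(1)] Dom_act[OF e generic_Asg r(1)] eq by simp
    also have "\<dots> = e h"
      by (rule dependsD[OF depends_params[OF e] a h]) (simp add: r(2) p[symmetric])
    finally show "d h = e h" .
  qed
qed

section \<open>Henkin axioms\<close>

text \<open>A list, so that the codes of \<sigma> on the support can be read off from a witness
  position by position.\<close>

definition supp :: "'b \<Rightarrow> 'v list" where
  "supp p = (SOME us. form_support {X} A X p (set us))"

lemma supp: "p \<in> P \<Longrightarrow> form_support {X} A X p (set (supp p))"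
  unfolding supp_def by (rule someI_ex) (metis form_support_exists finite_list)

lemma supp_subset: "p \<in> P \<Longrightarrow> set (supp p) \<subseteq> X"
  using supp[of p] by (simp add: form_support_def)

text \<open>
  The Henkin witness for \<open>\<forall>x.p\<close> instantiated by \<open>\<sigma>\<close>. Encoding its data makes it longer than
  every parameter it depends on, so that among finitely many witnesses the longest is fresh for
  the Henkin axioms of the others.
\<close>

definition wit :: "'v \<Rightarrow> 'b \<Rightarrow> ('v \<Rightarrow> (('a + 'b) list \<Rightarrow> 'a) \<Rightarrow> 'a) \<Rightarrow> ('a + 'b) list" where
  "wit x p \<sigma> = Inl (var A X x) # Inr p # enc (map (\<lambda>u. code (\<sigma> u)) (supp p))"

definition henk ::
  "'v \<Rightarrow> 'b \<Rightarrow> ('v \<Rightarrow> (('a + 'b) list \<Rightarrow> 'a) \<Rightarrow> 'a) \<Rightarrow> (('a + 'b) list \<Rightarrow> 'a) \<Rightarrow> 'b" where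
  "henk x p \<sigma> h = L.compl (psub p ((inst \<sigma> h)(x := h (wit x p \<sigma>)))) \<squnion>\<^bsub>L\<^esub>
     psub (univ A X x p) (inst \<sigma> h)"

lemma henk_closed:
  assumes "x \<in> X" "p \<in> P" "\<sigma> \<in> X \<rightarrow> Dom" "h \<in> Asg"
  shows "henk x p \<sigma> h \<in> P"
  unfolding henk_def
  using assms
  by (intro L.join_closed L.compl_closed psub_closed univ_closed upd_Substs inst_Substs Asg_closed)

text \<open>Each parameter of \<sigma> u is shorter than the code of \<sigma> u, and each such code
  is shorter than the witness.\<close>

lemma inst_short_cong:
  assumes \<sigma>: "\<sigma> \<in> X \<rightarrow> Dom" and p: "p \<in> P" and h: "h \<in> Asg" "h' \<in> Asg"
    and eq: "\<And>v. length v < length (wit x p \<sigma>) \<Longrightarrow> h v = h' v"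
    and u: "u \<in> set (supp p)"
  shows "inst \<sigma> h u = inst \<sigma> h' u"
proof -
  have uX: "u \<in> X" using u supp_subset[OF p] by auto
  then have d: "\<sigma> u \<in> Dom" using \<sigma> by auto
  have "\<sigma> u h = \<sigma> u h'"
  proof (rule dependsD[OF depends_params[OF d] h])
    fix v assume "v \<in> set (params (\<sigma> u))"
    then have "length v < length (code (\<sigma> u))" by (rule length_code)
    moreover have "length (code (\<sigma> u)) < length (enc (map (\<lambda>u. code (\<sigma> u)) (supp p)))"
      using u by (intro length_enc) simp
    ultimately show "h v = h' v" by (intro eq) (simp add: wit_def)
  qed
  then show ?thesis using uX by (simp add: inst_def)
qed

lemma psub_inst_cong:
  assumes p: "p \<in> P" and x: "x \<in> X" and S: "\<rho> \<in> Substs" "\<rho>' \<in> Substs" and t: "t \<in> T"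
    and eq: "\<And>u. u \<in> set (supp p) \<Longrightarrow> \<rho> u = \<rho>' u"
  shows "psub p (\<rho>(x := t)) = psub p (\<rho>'(x := t))"
    and "psub (univ A X x p) \<rho> = psub (univ A X x p) \<rho>'"
proof -
  show "psub p (\<rho>(x := t)) = psub p (\<rho>'(x := t))"
    by (rule form_supportD[OF supp[OF p] upd_Substs[OF S(1) x t] upd_Substs[OF S(2) x t]])
      (simp add: eq)
  show "psub (univ A X x p) \<rho> = psub (univ A X x p) \<rho>'"
    by (rule univ_psub_cong[OF p x supp[OF p] S]) (rule eq)
qed

text \<open>A Henkin axiom looks only at its witness and at shorter parameters. Hence a new value
  for a different witness that is at least as long does not disturb it.\<close>

lemma henk_cong:
  assumes x: "x \<in> X" and p: "p \<in> P" and \<sigma>: "\<sigma> \<in> X \<rightarrow> Dom" and h: "h \<in> Asg" "h' \<in> Asg"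
    and eq: "\<And>v. length v < length (wit x p \<sigma>) \<Longrightarrow> h v = h' v"
    and eqw: "h (wit x p \<sigma>) = h' (wit x p \<sigma>)"
  shows "henk x p \<sigma> h = henk x p \<sigma> h'"
  unfolding henk_def eqw
  using psub_inst_cong[OF p x inst_Substs[OF \<sigma> h(1)] inst_Substs[OF \<sigma> h(2)]
      Asg_closed[OF h(2)] inst_short_cong[OF \<sigma> p h eq]]
  by simp

text \<open>A witness records \<sigma> only on the support of \<open>p\<close>, but this already
  determines the axiom. Thus one value of a shared witness serves all axioms that use it.\<close>

lemma henk_wit_cong:
  assumes x: "x \<in> X" "x' \<in> X" and p: "p \<in> P" "p' \<in> P"
    and \<sigma>: "\<sigma> \<in> X \<rightarrow> Dom" "\<sigma>' \<in> X \<rightarrow> Dom" and h: "h \<in> Asg"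
    and w: "wit x p \<sigma> = wit x' p' \<sigma>'"
  shows "henk x p \<sigma> h = henk x' p' \<sigma>' h"
proof -
  have xx: "x' = x" and pp: "p' = p"
    and c: "map (\<lambda>u. code (\<sigma> u)) (supp p) = map (\<lambda>u. code (\<sigma>' u)) (supp p)"
    using w x inj_var by (auto simp: wit_def enc_eq_iff inj_on_def)
  have eq: "inst \<sigma> h u = inst \<sigma>' h u" if "u \<in> set (supp p)" for u
  proof -
    have u: "u \<in> X" using that supp_subset[OF p(1)] by auto
    then have "\<sigma> u = \<sigma>' u" using c that \<sigma> by (intro inj_onD[OF inj_code]) auto
    then show ?thesis by (simp add: inst_def)
  qed
  show ?thesis
    unfolding henk_def w xx pp
    using psub_inst_cong[OF p(1) x(1) inst_Substs[OF \<sigma>(1) h] inst_Substs[OF \<sigma>(2) h]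
        Asg_closed[OF h] eq]
    by simp
qed

text \<open>The new \<open>q'\<close> is the meet of \<open>q\<close> with the axiom. Were it zero,
  \<open>q\<close> would lie below \<open>a\<close> and below the complement of the instance
  \<open>?g\<close> of \<forall>x.p; but then q = \<forall>y.q \<le> \<forall>y.a, which is
  \<open>?g\<close> itself.\<close>

lemma henk_step:
  assumes h: "h \<in> Asg" and q: "q \<in> P" "q \<noteq> \<bottom>\<^bsub>L\<^esub>"
    and x: "x \<in> X" and p: "p \<in> P" and \<sigma>: "\<sigma> \<in> X \<rightarrow> Dom"
  obtains t q' where "t \<in> T" "q' \<in> P" "q' \<noteq> \<bottom>\<^bsub>L\<^esub>" "q' \<sqsubseteq>\<^bsub>L\<^esub> q"
    and "q' \<sqsubseteq>\<^bsub>L\<^esub> henk x p \<sigma> (h(wit x p \<sigma> := t))"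
proof -
  let ?\<rho> = "inst \<sigma> h"
  let ?g = "psub (univ A X x p) ?\<rho>"
  have \<rho>: "?\<rho> \<in> Substs" using \<sigma> h by (rule inst_Substs)
  obtain y where y: "y \<in> X" "univ A X y q = q"
    and *: "\<And>\<tau>. \<tau> \<in> {?\<rho>} \<Longrightarrow> psub (univ A X x p) \<tau> = univ A X y (psub p (\<tau>(x := var A X y)))"
    by (rule univ_psub[OF p x _ _ q(1), of "{?\<rho>}"]) (use \<rho> in auto)
  let ?t = "var A X y"
  let ?h = "h(wit x p \<sigma> := ?t)"
  have t: "?t \<in> T" using y(1) by (rule var_closed)
  have h': "?h \<in> Asg" using h t by (rule Asg_upd)
  define a where "a = psub p (?\<rho>(x := ?t))"
  have a: "a \<in> P" unfolding a_def by (intro psub_closed p upd_Substs \<rho> x t)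
  have g: "?g \<in> P" by (intro psub_closed univ_closed p x \<rho>)
  have eq: "inst \<sigma> h u = inst \<sigma> ?h u" if "u \<in> set (supp p)" for u
    by (rule inst_short_cong[OF \<sigma> p h h' _ that, of x]) auto
  have henk: "henk x p \<sigma> ?h = L.compl a \<squnion>\<^bsub>L\<^esub> ?g"
    unfolding henk_def a_def
    using psub_inst_cong[OF p x \<rho> inst_Substs[OF \<sigma> h'] t eq] by simp
  have hP: "L.compl a \<squnion>\<^bsub>L\<^esub> ?g \<in> P" by (intro L.join_closed L.compl_closed a g)
  have "q \<sqinter>\<^bsub>L\<^esub> (L.compl a \<squnion>\<^bsub>L\<^esub> ?g) \<noteq> \<bottom>\<^bsub>L\<^esub>"
  proof
    assume "q \<sqinter>\<^bsub>L\<^esub> (L.compl a \<squnion>\<^bsub>L\<^esub> ?g) = \<bottom>\<^bsub>L\<^esub>"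
    then have 1: "q \<sqsubseteq>\<^bsub>L\<^esub> a" and 2: "q \<sqsubseteq>\<^bsub>L\<^esub> L.compl ?g"
      using L.meet_join_eq_bottom[OF q(1) L.compl_closed[OF a] g]
        L.meet_compl_eq_bottom_iff[OF q(1) a] L.meet_eq_bottom_iff[OF q(1) g] by blast+
    have "q \<sqsubseteq>\<^bsub>L\<^esub> ?g"
      using univ_mono[OF y(1) q(1) a 1] y(2) * by (simp add: a_def)
    then show False using L.le_compl_contra[OF q(1) g _ 2] q(2) by blast
  qed
  then show thesis
    using that[OF t, of "q \<sqinter>\<^bsub>L\<^esub> (L.compl a \<squnion>\<^bsub>L\<^esub> ?g)"] q(1) hP
    unfolding henk by (blast intro: L.meet_closed L.meet_left L.meet_right)
qed

text \<open>The assignment of parameters to the variables under which \<open>J\<close> is to become true.\<close>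

definition std :: "'v \<Rightarrow> (('a + 'b) list \<Rightarrow> 'a) \<Rightarrow> 'a" where
  "std x = (\<lambda>h\<in>Asg. h [Inl (var A X x)])"

lemma std_Dom: "std \<in> X \<rightarrow> Dom"
  by (simp add: std_def point_Dom)

definition satisfiable :: "((('a + 'b) list \<Rightarrow> 'a) \<Rightarrow> 'b) set \<Rightarrow> bool" where
  "satisfiable K \<longleftrightarrow> (\<forall>K0. finite K0 \<longrightarrow> K0 \<subseteq> K \<longrightarrow>
     (\<exists>h\<in>Asg. \<exists>q\<in>P. q \<noteq> \<bottom>\<^bsub>L\<^esub> \<and> (\<forall>g\<in>K0. q \<sqsubseteq>\<^bsub>L\<^esub> g h)))"

definition henkin_axioms :: "((('a + 'b) list \<Rightarrow> 'a) \<Rightarrow> 'b) set" where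
  "henkin_axioms = {henk x p \<sigma> | x p \<sigma>. x \<in> X \<and> p \<in> P \<and> \<sigma> \<in> X \<rightarrow> Dom}"

text \<open>The longest witness is added last, so by \<open>henk_cong\<close> its new value affects
  no axiom treated before, and the bound \<open>q\<close> only shrinks. The induction runs over
  witnesses and not over axioms because several instantiations can share a witness.\<close>

lemma finite_henkin_satisfiable:
  assumes J: "J0 \<subseteq> P" and q0: "q0 \<in> P" "q0 \<noteq> \<bottom>\<^bsub>L\<^esub>" "\<forall>p\<in>J0. q0 \<sqsubseteq>\<^bsub>L\<^esub> p" and W: "finite W"
  shows "\<exists>h\<in>Asg. \<exists>q\<in>P. q \<noteq> \<bottom>\<^bsub>L\<^esub> \<and> (\<forall>p\<in>J0. q \<sqsubseteq>\<^bsub>L\<^esub> psub p (inst std h)) \<and>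
    (\<forall>x\<in>X. \<forall>p\<in>P. \<forall>\<sigma>\<in>X \<rightarrow> Dom. wit x p \<sigma> \<in> W \<longrightarrow> q \<sqsubseteq>\<^bsub>L\<^esub> henk x p \<sigma> h)"
  using W
proof (induction W rule: finite_ranking_induct[where f = length])
  case empty
  obtain x0 where x0: "x0 \<in> X" using vars_nonempty by blast
  \<comment> \<open>Each variable's own parameter is assigned that variable, so that
    \<open>inst std h\<close> is the identity substitution; \<open>x0\<close> is an arbitrary
    default.\<close>
  define h where "h v = (if \<exists>x\<in>X. v = [Inl (var A X x)] then projl (hd v) else var A X x0)"
    for v :: "('a + 'b) list"
  have h: "h \<in> Asg" using x0 by (auto simp: Asg_def h_def var_closed)
  have "inst std h = var A X"
  proof
    show "inst std h x = var A X x" for x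
      using h var_Substs by (auto simp: inst_def std_def h_def PiE_iff extensional_def)
  qed
  then have "psub p (inst std h) = p" if "p \<in> P" for p
    using P1_form[OF _ vars_nonempty that] by simp
  then show ?case using h q0 J by (intro bexI[of _ h] bexI[of _ q0]) auto
next
  case (insert w W)
  then obtain h q where h: "h \<in> Asg" and q: "q \<in> P" "q \<noteq> \<bottom>\<^bsub>L\<^esub>"
    and qJ: "\<And>p. p \<in> J0 \<Longrightarrow> q \<sqsubseteq>\<^bsub>L\<^esub> psub p (inst std h)"
    and qW: "\<And>x p \<sigma>. \<lbrakk>x \<in> X; p \<in> P; \<sigma> \<in> X \<rightarrow> Dom; wit x p \<sigma> \<in> W\<rbrakk> \<Longrightarrow> q \<sqsubseteq>\<^bsub>L\<^esub> henk x p \<sigma> h"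
    by blast
  show ?case
  proof (cases "w \<in> W \<or> \<not> (\<exists>x\<in>X. \<exists>p\<in>P. \<exists>\<sigma>\<in>X \<rightarrow> Dom. wit x p \<sigma> = w)")
    case True
    then show ?thesis using h q qJ qW by (intro bexI[of _ h] bexI[of _ q]) blast+
  next
    case False
    then obtain x p \<sigma> where x: "x \<in> X" and p: "p \<in> P" and \<sigma>: "\<sigma> \<in> X \<rightarrow> Dom"
      and w: "wit x p \<sigma> = w" by blast
    obtain t q' where t: "t \<in> T" and q': "q' \<in> P" "q' \<noteq> \<bottom>\<^bsub>L\<^esub>" "q' \<sqsubseteq>\<^bsub>L\<^esub> q"
      and le: "q' \<sqsubseteq>\<^bsub>L\<^esub> henk x p \<sigma> (h(w := t))"
      using henk_step[OF h q x p \<sigma>] w by metis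
    define h' where "h' = h(w := t)"
    have h': "h' \<in> Asg" unfolding h'_def using h t by (rule Asg_upd)
    \<comment> \<open>The parameters of \<open>std\<close> are lists of length 1, so a new value at
      a witness cannot change them.\<close>
    have len: "length w \<ge> 2" using w by (auto simp: wit_def)
    have "inst std h' = inst std h"
      using h h' len by (intro ext) (auto simp: inst_def std_def h'_def)
    then have J': "q' \<sqsubseteq>\<^bsub>L\<^esub> psub r (inst std h')" if "r \<in> J0" for r
      using L.le_trans[OF q'(3) qJ[OF that] q'(1) q(1)] that J inst_Substs[OF std_Dom h] psub_closed
      by (simp add: subset_eq)
    have W': "q' \<sqsubseteq>\<^bsub>L\<^esub> henk y r \<tau> h'"
      if y: "y \<in> X" "r \<in> P" "\<tau> \<in> X \<rightarrow> Dom" and yw: "wit y r \<tau> \<in> insert w W" for y r \<tau>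
    proof (cases "wit y r \<tau> = w")
      case True
      then show ?thesis
        using henk_wit_cong[OF x y(1) p y(2) \<sigma> y(3) h'] w le by (simp add: h'_def)
    next
      case False
      then have yW: "wit y r \<tau> \<in> W" using yw by simp
      then have "length (wit y r \<tau>) \<le> length w" by (rule insert.hyps)
      then have "henk y r \<tau> h = henk y r \<tau> h'"
        using False by (intro henk_cong[OF y h h']) (auto simp: h'_def)
      then show ?thesis
        using L.le_trans[OF q'(3) qW[OF y yW] q'(1) q(1) henk_closed[OF y h]] by simp
    qed
    show ?thesis using h' q'(1,2) J' W' by (intro bexI[of _ h'] bexI[of _ q']) auto
  qed
qed

lemma henkin_satisfiable:
  assumes J: "J \<subseteq> P" "consistent L J"
  shows "satisfiable ((\<lambda>p h. psub p (inst std h)) ` J \<union> henkin_axioms)"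
  unfolding satisfiable_def
proof (intro allI impI)
  fix K assume K: "finite K" "K \<subseteq> (\<lambda>p h. psub p (inst std h)) ` J \<union> henkin_axioms"
  obtain J0 where J0: "J0 \<subseteq> J" "finite J0"
    "K \<inter> (\<lambda>p h. psub p (inst std h)) ` J = (\<lambda>p h. psub p (inst std h)) ` J0"
    using finite_subset_image[of "K \<inter> (\<lambda>p h. psub p (inst std h)) ` J"] K(1)
    by (metis finite_Int inf_le2)
  obtain q0 where q0: "q0 \<in> P" "q0 \<noteq> \<bottom>\<^bsub>L\<^esub>" "\<forall>p\<in>J0. q0 \<sqsubseteq>\<^bsub>L\<^esub> p"
    using consistent_lower_bound[OF L.boolean_lattice_axioms J(2) J0(2,1)] by blast
  have "\<forall>g\<in>K \<inter> henkin_axioms. \<exists>w. \<exists>x\<in>X. \<exists>p\<in>P. \<exists>\<sigma>\<in>X \<rightarrow> Dom. g = henk x p \<sigma> \<and> wit x p \<sigma> = w"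
    unfolding henkin_axioms_def by blast
  then obtain f where f: "\<forall>g\<in>K \<inter> henkin_axioms.
      \<exists>x\<in>X. \<exists>p\<in>P. \<exists>\<sigma>\<in>X \<rightarrow> Dom. g = henk x p \<sigma> \<and> wit x p \<sigma> = f g"
    by metis
  have "finite (f ` (K \<inter> henkin_axioms))" using K(1) by simp
  moreover have "J0 \<subseteq> P" using J0(1) J(1) by blast
  ultimately obtain h q where h: "h \<in> Asg" "q \<in> P" "q \<noteq> \<bottom>\<^bsub>L\<^esub>"
    "\<forall>p\<in>J0. q \<sqsubseteq>\<^bsub>L\<^esub> psub p (inst std h)"
    and W: "\<forall>x\<in>X. \<forall>p\<in>P. \<forall>\<sigma>\<in>X \<rightarrow> Dom. wit x p \<sigma> \<in> f ` (K \<inter> henkin_axioms) \<longrightarrow> q \<sqsubseteq>\<^bsub>L\<^esub> henk x p \<sigma> h"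
    using finite_henkin_satisfiable[OF _ q0] by meson
  have "q \<sqsubseteq>\<^bsub>L\<^esub> g h" if "g \<in> K" for g
  proof (cases "g \<in> henkin_axioms")
    case True
    then have g: "g \<in> K \<inter> henkin_axioms" using that by blast
    then obtain x p \<sigma> where *: "x \<in> X" "p \<in> P" "\<sigma> \<in> X \<rightarrow> Dom" "g = henk x p \<sigma>" "wit x p \<sigma> = f g"
      using f by blast
    then have "wit x p \<sigma> \<in> f ` (K \<inter> henkin_axioms)" using g by simp
    then show ?thesis using W * by blast
  next
    case False
    then have "g \<in> (\<lambda>p h. psub p (inst std h)) ` J0" using that K(2) J0(3) by blast
    then show ?thesis using h(4) by blast
  qed
  then show "\<exists>h\<in>Asg. \<exists>q\<in>P. q \<noteq> \<bottom>\<^bsub>L\<^esub> \<and> (\<forall>g\<in>K. q \<sqsubseteq>\<^bsub>L\<^esub> g h)" using h by blast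
qed

section \<open>Existence of maximal satisfiable sets\<close>

definition PForms :: "((('a + 'b) list \<Rightarrow> 'a) \<Rightarrow> 'b) set" where
  "PForms = {g. \<forall>h\<in>Asg. g h \<in> P}"

text \<open>Satisfiability has finite character: a finite part of the union of a chain lies in one
  member. So Zorn's lemma applies.\<close>

lemma maximal_satisfiable:
  assumes "K \<subseteq> PForms" "satisfiable K"
  obtains M where "K \<subseteq> M" "M \<subseteq> PForms" "satisfiable M"
    and "\<And>g. \<lbrakk>g \<in> PForms; satisfiable (insert g M)\<rbrakk> \<Longrightarrow> g \<in> M"
proof -
  define S where "S = {M. K \<subseteq> M \<and> M \<subseteq> PForms \<and> satisfiable M}"
  have "K \<in> S" using assms by (simp add: S_def)
  have "\<exists>M\<in>S. \<forall>N\<in>S. M \<subseteq> N \<longrightarrow> N = M"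
  proof (rule subset_Zorn_nonempty)
    show "S \<noteq> {}" using \<open>K \<in> S\<close> by blast
    fix C assume C: "C \<noteq> {}" "subset.chain S C"
    then have CS: "M \<in> S" if "M \<in> C" for M using that by (auto simp: subset_chain_def)
    have "satisfiable (\<Union>C)"
      unfolding satisfiable_def
    proof (intro allI impI)
      fix K0 assume K0: "finite K0" "K0 \<subseteq> \<Union>C"
      then obtain M where M: "M \<in> C" "K0 \<subseteq> M"
        by (rule finite_subset_Union_chain[OF _ _ C])
      then have "satisfiable M" using CS[OF M(1)] by (simp add: S_def)
      then show "\<exists>h\<in>Asg. \<exists>q\<in>P. q \<noteq> \<bottom>\<^bsub>L\<^esub> \<and> (\<forall>g\<in>K0. q \<sqsubseteq>\<^bsub>L\<^esub> g h)"
        using K0(1) M(2) unfolding satisfiable_def by blast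
    qed
    moreover have "\<Union>C \<subseteq> PForms" using CS by (auto simp: S_def)
    moreover have "K \<subseteq> \<Union>C"
    proof -
      obtain M where M: "M \<in> C" using C(1) by blast
      then show ?thesis using CS[OF M] by (auto simp: S_def)
    qed
    ultimately show "\<Union>C \<in> S" by (simp add: S_def)
  qed
  then obtain M where M: "M \<in> S" and max: "\<And>N. N \<in> S \<Longrightarrow> M \<subseteq> N \<Longrightarrow> N = M" by blast
  show thesis
  proof (rule that)
    show "K \<subseteq> M" "M \<subseteq> PForms" "satisfiable M" using M by (simp_all add: S_def)
    fix g assume "g \<in> PForms" "satisfiable (insert g M)"
    then have "insert g M \<in> S" using M by (auto simp: S_def)
    then show "g \<in> M" using max[of "insert g M"] by blast
  qed
qed

end

section \<open>Maximal satisfiable sets\<close>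

locale complete_henkin_set = locally_finite_algebra X A
  for X :: "'v set" and A :: "('v, 'a, 'b) qtheory" +
  fixes M :: "((('a + 'b) list \<Rightarrow> 'a) \<Rightarrow> 'b) set"
  assumes M_PForms: "M \<subseteq> PForms" and M_satisfiable: "satisfiable M"
    and M_maximal: "\<lbrakk>g \<in> PForms; satisfiable (insert g M)\<rbrakk> \<Longrightarrow> g \<in> M"
    and M_henkin: "henkin_axioms \<subseteq> M"
begin

lemma M_bound:
  assumes "finite K" "K \<subseteq> M"
  obtains h q where "h \<in> Asg" "q \<in> P" "q \<noteq> \<bottom>\<^bsub>L\<^esub>" "\<And>g. g \<in> K \<Longrightarrow> q \<sqsubseteq>\<^bsub>L\<^esub> g h"
proof -
  have "\<exists>h\<in>Asg. \<exists>q\<in>P. q \<noteq> \<bottom>\<^bsub>L\<^esub> \<and> (\<forall>g\<in>K. q \<sqsubseteq>\<^bsub>L\<^esub> g h)"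
    using M_satisfiable[unfolded satisfiable_def, rule_format, OF assms] .
  then show thesis using that by blast
qed

text \<open>An assignment and a bound that work for \<open>K\<close> and the rest of a finite part
  also work for \<open>g\<close>, so adding \<open>g\<close> keeps satisfiability and maximality
  puts it into \<open>M\<close>.\<close>

lemma M_entails:
  assumes K: "finite K" "K \<subseteq> M" and g: "g \<in> PForms"
    and ent: "\<And>h q. \<lbrakk>h \<in> Asg; q \<in> P; \<And>k. k \<in> K \<Longrightarrow> q \<sqsubseteq>\<^bsub>L\<^esub> k h\<rbrakk> \<Longrightarrow> q \<sqsubseteq>\<^bsub>L\<^esub> g h"
  shows "g \<in> M"
proof (rule M_maximal[OF g])
  show "satisfiable (insert g M)"
    unfolding satisfiable_def
  proof (intro allI impI)
    fix K0 assume K0: "finite K0" "K0 \<subseteq> insert g M"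
    obtain h q where hq: "h \<in> Asg" "q \<in> P" "q \<noteq> \<bottom>\<^bsub>L\<^esub>"
      and le: "\<And>k. k \<in> (K0 - {g}) \<union> K \<Longrightarrow> q \<sqsubseteq>\<^bsub>L\<^esub> k h"
      by (rule M_bound[of "(K0 - {g}) \<union> K"]) (use K K0 in auto)
    have "q \<sqsubseteq>\<^bsub>L\<^esub> g h" by (rule ent[OF hq(1,2)]) (simp add: le)
    then have "q \<sqsubseteq>\<^bsub>L\<^esub> k h" if "k \<in> K0" for k using le[of k] that by (cases "k = g") auto
    then show "\<exists>h\<in>Asg. \<exists>q\<in>P. q \<noteq> \<bottom>\<^bsub>L\<^esub> \<and> (\<forall>g\<in>K0. q \<sqsubseteq>\<^bsub>L\<^esub> g h)" using hq by blast
  qed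
qed

lemma PFormsD: "\<lbrakk>g \<in> PForms; h \<in> Asg\<rbrakk> \<Longrightarrow> g h \<in> P"
  by (simp add: PForms_def)

lemma compl_PForms: "g \<in> PForms \<Longrightarrow> (\<lambda>h. L.compl (g h)) \<in> PForms"
  by (simp add: PForms_def L.compl_closed)

text \<open>If neither function could be added, each would be refuted by a finite part. The members
  of both parts that lie in \<open>M\<close> have a common \<open>h\<close> and a nonzero
  \<open>q\<close>, and \<open>q\<close> meets \<open>g h\<close> or its complement in something
  nonzero, contrary to one of the refutations.\<close>

lemma M_compl:
  assumes g: "g \<in> PForms"
  shows "(\<lambda>h. L.compl (g h)) \<in> M \<longleftrightarrow> g \<notin> M"
proof
  let ?c = "\<lambda>h. L.compl (g h)"
  assume c: "?c \<in> M"
  show "g \<notin> M"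
  proof
    assume g': "g \<in> M"
    obtain h q where hq: "h \<in> Asg" "q \<in> P" "q \<noteq> \<bottom>\<^bsub>L\<^esub>"
      and le: "\<And>k. k \<in> {g, ?c} \<Longrightarrow> q \<sqsubseteq>\<^bsub>L\<^esub> k h"
      by (rule M_bound[of "{g, ?c}"]) (use c g' in auto)
    show False
      using L.le_compl_contra[OF hq(2) PFormsD[OF g hq(1)]] le[of g] le[of ?c] hq(3) by simp
  qed
next
  let ?c = "\<lambda>h. L.compl (g h)"
  assume "g \<notin> M"
  then have 1: "\<not> satisfiable (insert g M)" using M_maximal[OF g] by blast
  show "?c \<in> M"
  proof (rule ccontr)
    assume "?c \<notin> M"
    then have 2: "\<not> satisfiable (insert ?c M)" using M_maximal[OF compl_PForms[OF g]] by blast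
    obtain K where K: "finite K" "K \<subseteq> insert g M"
      and noK: "\<not> (\<exists>h\<in>Asg. \<exists>q\<in>P. q \<noteq> \<bottom>\<^bsub>L\<^esub> \<and> (\<forall>k\<in>K. q \<sqsubseteq>\<^bsub>L\<^esub> k h))"
      using 1 unfolding satisfiable_def by blast
    obtain K' where K': "finite K'" "K' \<subseteq> insert ?c M"
      and noK': "\<not> (\<exists>h\<in>Asg. \<exists>q\<in>P. q \<noteq> \<bottom>\<^bsub>L\<^esub> \<and> (\<forall>k\<in>K'. q \<sqsubseteq>\<^bsub>L\<^esub> k h))"
      using 2 unfolding satisfiable_def by blast
    let ?K = "(K - {g}) \<union> (K' - {?c})"
    obtain h q where h: "h \<in> Asg" and q: "q \<in> P" "q \<noteq> \<bottom>\<^bsub>L\<^esub>"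
      and le: "\<And>k. k \<in> ?K \<Longrightarrow> q \<sqsubseteq>\<^bsub>L\<^esub> k h"
      by (rule M_bound[of ?K]) (use K K' in auto)
    have gh: "g h \<in> P" using g h by (rule PFormsD)
    have le': "q \<sqinter>\<^bsub>L\<^esub> r \<sqsubseteq>\<^bsub>L\<^esub> k h" if "k \<in> ?K" "r \<in> P" for k r
    proof -
      have "k h \<in> P" using that(1) K(2) K'(2) M_PForms h by (auto intro: PFormsD)
      then show ?thesis
        using L.le_trans[OF L.meet_left[OF q(1) that(2)] le[OF that(1)]] q(1) that(2) by simp
    qed
    consider "q \<sqinter>\<^bsub>L\<^esub> g h \<noteq> \<bottom>\<^bsub>L\<^esub>" | "q \<sqinter>\<^bsub>L\<^esub> L.compl (g h) \<noteq> \<bottom>\<^bsub>L\<^esub>"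
      using L.meet_or_meet_compl[OF q gh] by blast
    then show False
    proof cases
      case 1
      have "q \<sqinter>\<^bsub>L\<^esub> g h \<sqsubseteq>\<^bsub>L\<^esub> k h" if "k \<in> K" for k
        using le'[of k "g h"] L.meet_right[OF q(1) gh] that gh by (cases "k = g") auto
      then show False using noK h 1 L.meet_closed[OF q(1) gh] by blast
    next
      case 2
      note c = L.compl_closed[OF gh]
      have "q \<sqinter>\<^bsub>L\<^esub> L.compl (g h) \<sqsubseteq>\<^bsub>L\<^esub> k h" if "k \<in> K'" for k
        using le'[of k "L.compl (g h)"] L.meet_right[OF q(1) c] that c by (cases "k = ?c") auto
      then show False using noK' h 2 L.meet_closed[OF q(1) c] by blast
    qed
  qed
qed

lemma M_top: "\<lbrakk>\<And>h. h \<in> Asg \<Longrightarrow> g h = \<top>\<^bsub>L\<^esub>\<rbrakk> \<Longrightarrow> g \<in> M"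
  by (rule M_entails[of "{}"]) (simp_all add: PForms_def)

lemma M_bottom:
  assumes "\<And>h. h \<in> Asg \<Longrightarrow> g h = \<bottom>\<^bsub>L\<^esub>"
  shows "g \<notin> M"
proof
  assume g: "g \<in> M"
  obtain h q where h: "h \<in> Asg" and q: "q \<in> P" "q \<noteq> \<bottom>\<^bsub>L\<^esub>"
    and le: "\<And>k. k \<in> {g} \<Longrightarrow> q \<sqsubseteq>\<^bsub>L\<^esub> k h"
    by (rule M_bound[of "{g}"]) (use g in auto)
  show False using le[of g] assms[OF h] L.le_bottom[OF _ q(1)] q(2) by simp
qed

lemma M_mono:
  assumes "f \<in> M" "g \<in> PForms" "\<And>h. h \<in> Asg \<Longrightarrow> f h \<sqsubseteq>\<^bsub>L\<^esub> g h"
  shows "g \<in> M"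
proof (rule M_entails[of "{f}"])
  fix h q assume *: "h \<in> Asg" "q \<in> P" "\<And>k. k \<in> {f} \<Longrightarrow> q \<sqsubseteq>\<^bsub>L\<^esub> k h"
  have "f h \<in> P" using assms(1) M_PForms *(1) by (auto intro: PFormsD)
  then show "q \<sqsubseteq>\<^bsub>L\<^esub> g h"
    using L.le_trans[OF *(3)[of f] assms(3)[OF *(1)]] *(2) PFormsD[OF assms(2) *(1)] by simp
qed (use assms in auto)

lemma M_meet:
  assumes f: "f \<in> PForms" and g: "g \<in> PForms"
  shows "(\<lambda>h. f h \<sqinter>\<^bsub>L\<^esub> g h) \<in> M \<longleftrightarrow> f \<in> M \<and> g \<in> M"
proof (intro iffI conjI)
  assume *: "(\<lambda>h. f h \<sqinter>\<^bsub>L\<^esub> g h) \<in> M"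
  show "f \<in> M" by (rule M_mono[OF * f]) (intro L.meet_left PFormsD[OF f] PFormsD[OF g])
  show "g \<in> M" by (rule M_mono[OF * g]) (intro L.meet_right PFormsD[OF f] PFormsD[OF g])
next
  assume *: "f \<in> M \<and> g \<in> M"
  show "(\<lambda>h. f h \<sqinter>\<^bsub>L\<^esub> g h) \<in> M"
  proof (rule M_entails[of "{f, g}"])
    show "(\<lambda>h. f h \<sqinter>\<^bsub>L\<^esub> g h) \<in> PForms" using f g by (simp add: PForms_def)
    fix h q assume h: "h \<in> Asg" "q \<in> P" "\<And>k. k \<in> {f, g} \<Longrightarrow> q \<sqsubseteq>\<^bsub>L\<^esub> k h"
    then show "q \<sqsubseteq>\<^bsub>L\<^esub> f h \<sqinter>\<^bsub>L\<^esub> g h"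
      using L.le_meet_iff[OF PFormsD[OF f h(1)] PFormsD[OF g h(1)] h(2)] by blast
  qed (use * in auto)
qed

lemma M_join:
  assumes f: "f \<in> PForms" and g: "g \<in> PForms"
  shows "(\<lambda>h. f h \<squnion>\<^bsub>L\<^esub> g h) \<in> M \<longleftrightarrow> f \<in> M \<or> g \<in> M"
proof
  let ?j = "\<lambda>h. f h \<squnion>\<^bsub>L\<^esub> g h"
  have j: "?j \<in> PForms" using f g by (simp add: PForms_def)
  show "?j \<in> M" if "f \<in> M \<or> g \<in> M"
    using that
  proof
    assume "f \<in> M"
    then show ?thesis by (rule M_mono[OF _ j]) (intro L.join_left PFormsD[OF f] PFormsD[OF g])
  next
    assume "g \<in> M"
    then show ?thesis by (rule M_mono[OF _ j]) (intro L.join_right PFormsD[OF f] PFormsD[OF g])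
  qed
  assume *: "?j \<in> M"
  show "f \<in> M \<or> g \<in> M"
  proof (rule ccontr)
    assume "\<not> (f \<in> M \<or> g \<in> M)"
    then have c: "(\<lambda>h. L.compl (f h)) \<in> M" "(\<lambda>h. L.compl (g h)) \<in> M"
      using M_compl f g by blast+
    obtain h q where hq: "h \<in> Asg" "q \<in> P" "q \<noteq> \<bottom>\<^bsub>L\<^esub>"
      and le: "\<And>k. k \<in> {?j, \<lambda>h. L.compl (f h), \<lambda>h. L.compl (g h)} \<Longrightarrow> q \<sqsubseteq>\<^bsub>L\<^esub> k h"
      by (rule M_bound[of "{?j, \<lambda>h. L.compl (f h), \<lambda>h. L.compl (g h)}"]) (use * c in auto)
    show False
      using L.join_compl_compl_contra[OF hq(2) PFormsD[OF f hq(1)] PFormsD[OF g hq(1)]]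
        le[of ?j] le[of "\<lambda>h. L.compl (f h)"] le[of "\<lambda>h. L.compl (g h)"] hq(3) by simp
  qed
qed

section \<open>Truth under an instantiation by terms with parameters\<close>

definition holds :: "'b \<Rightarrow> ('v \<Rightarrow> (('a + 'b) list \<Rightarrow> 'a) \<Rightarrow> 'a) \<Rightarrow> bool" where
  "holds p \<sigma> \<longleftrightarrow> (\<lambda>h. psub p (inst \<sigma> h)) \<in> M"

lemma psub_inst_PForms: "\<lbrakk>p \<in> P; \<sigma> \<in> X \<rightarrow> Dom\<rbrakk> \<Longrightarrow> (\<lambda>h. psub p (inst \<sigma> h)) \<in> PForms"
  by (simp add: PForms_def psub_closed inst_Substs)

lemma holds_cong:
  assumes "\<And>x. x \<in> X \<Longrightarrow> \<sigma> x = \<tau> x"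
  shows "holds p \<sigma> \<longleftrightarrow> holds p \<tau>"
proof -
  have "inst \<sigma> = inst \<tau>" by (intro ext) (simp add: inst_def assms)
  then show ?thesis by (simp add: holds_def)
qed

lemma inst_upd: "x \<in> X \<Longrightarrow> inst (\<sigma>(x := d)) h = (inst \<sigma> h)(x := d h)"
  by (intro ext) (simp add: inst_def)

lemma holds_hom:
  assumes "\<sigma> \<in> X \<rightarrow> Dom"
  shows holds_bottom: "\<not> holds \<bottom>\<^bsub>L\<^esub> \<sigma>" and holds_top: "holds \<top>\<^bsub>L\<^esub> \<sigma>"
    and holds_meet: "\<lbrakk>p \<in> P; q \<in> P\<rbrakk> \<Longrightarrow> holds (p \<sqinter>\<^bsub>L\<^esub> q) \<sigma> \<longleftrightarrow> holds p \<sigma> \<and> holds q \<sigma>"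
    and holds_join: "\<lbrakk>p \<in> P; q \<in> P\<rbrakk> \<Longrightarrow> holds (p \<squnion>\<^bsub>L\<^esub> q) \<sigma> \<longleftrightarrow> holds p \<sigma> \<or> holds q \<sigma>"
proof -
  have hom: "boolean_hom L L (\<lambda>p. psub p (inst \<sigma> h))" if "h \<in> Asg" for h
    using that assms by (intro psub_hom inst_Substs)
  show "\<not> holds \<bottom>\<^bsub>L\<^esub> \<sigma>"
    unfolding holds_def by (rule M_bottom) (use hom in \<open>simp add: boolean_hom_def\<close>)
  show "holds \<top>\<^bsub>L\<^esub> \<sigma>"
    unfolding holds_def by (rule M_top) (use hom in \<open>simp add: boolean_hom_def\<close>)
  have ext: "f \<in> M \<longleftrightarrow> g \<in> M" if "\<And>h. h \<in> Asg \<Longrightarrow> f h = g h" "f \<in> PForms" "g \<in> PForms" for f g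
    using M_mono[of f g] M_mono[of g f] that PFormsD by (metis L.le_refl)
  assume p: "p \<in> P" and q: "q \<in> P"
  let ?p = "\<lambda>h. psub p (inst \<sigma> h)" and ?q = "\<lambda>h. psub q (inst \<sigma> h)"
  note pq = psub_inst_PForms[OF p assms] psub_inst_PForms[OF q assms]
  have "holds (p \<sqinter>\<^bsub>L\<^esub> q) \<sigma> \<longleftrightarrow> (\<lambda>h. ?p h \<sqinter>\<^bsub>L\<^esub> ?q h) \<in> M"
    unfolding holds_def
  proof (rule ext)
    show "psub (p \<sqinter>\<^bsub>L\<^esub> q) (inst \<sigma> h) = ?p h \<sqinter>\<^bsub>L\<^esub> ?q h" if "h \<in> Asg" for h
      using hom[OF that] p q by (simp add: boolean_hom_def meet_pres_def)
  next
    show "(\<lambda>h. psub (p \<sqinter>\<^bsub>L\<^esub> q) (inst \<sigma> h)) \<in> PForms"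
      by (intro psub_inst_PForms L.meet_closed p q assms)
    show "(\<lambda>h. ?p h \<sqinter>\<^bsub>L\<^esub> ?q h) \<in> PForms" using pq by (simp add: PForms_def)
  qed
  then show "holds (p \<sqinter>\<^bsub>L\<^esub> q) \<sigma> \<longleftrightarrow> holds p \<sigma> \<and> holds q \<sigma>"
    using M_meet[OF pq] by (simp add: holds_def)
  have "holds (p \<squnion>\<^bsub>L\<^esub> q) \<sigma> \<longleftrightarrow> (\<lambda>h. ?p h \<squnion>\<^bsub>L\<^esub> ?q h) \<in> M"
    unfolding holds_def
  proof (rule ext)
    show "psub (p \<squnion>\<^bsub>L\<^esub> q) (inst \<sigma> h) = ?p h \<squnion>\<^bsub>L\<^esub> ?q h" if "h \<in> Asg" for h
      using hom[OF that] p q by (simp add: boolean_hom_def join_pres_def)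
  next
    show "(\<lambda>h. psub (p \<squnion>\<^bsub>L\<^esub> q) (inst \<sigma> h)) \<in> PForms"
      by (intro psub_inst_PForms L.join_closed p q assms)
    show "(\<lambda>h. ?p h \<squnion>\<^bsub>L\<^esub> ?q h) \<in> PForms" using pq by (simp add: PForms_def)
  qed
  then show "holds (p \<squnion>\<^bsub>L\<^esub> q) \<sigma> \<longleftrightarrow> holds p \<sigma> \<or> holds q \<sigma>"
    using M_join[OF pq] by (simp add: holds_def)
qed

text \<open>Instantiation (\<open>univ_psub_le\<close>) gives one direction at every assignment. For
  the other, a single element of the domain is tested, the witness for this \<open>x\<close>,
  \<open>p\<close> and \<sigma>; the Henkin axiom in \<open>M\<close> leads from there to
  \<forall>x.p.\<close>

lemma holds_univ:
  assumes x: "x \<in> X" and p: "p \<in> P" and \<sigma>: "\<sigma> \<in> X \<rightarrow> Dom"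
  shows "holds (univ A X x p) \<sigma> \<longleftrightarrow> (\<forall>d\<in>Dom. holds p (\<sigma>(x := d)))"
proof (intro iffI ballI)
  have upd: "\<sigma>(x := d) \<in> X \<rightarrow> Dom" if "d \<in> Dom" for d using \<sigma> that by auto
  fix d assume u: "holds (univ A X x p) \<sigma>" and d: "d \<in> Dom"
  show "holds p (\<sigma>(x := d))"
    unfolding holds_def
  proof (rule M_mono[OF u[unfolded holds_def] psub_inst_PForms[OF p upd[OF d]]])
    show "psub (univ A X x p) (inst \<sigma> h) \<sqsubseteq>\<^bsub>L\<^esub> psub p (inst (\<sigma>(x := d)) h)" if "h \<in> Asg" for h
      unfolding inst_upd[OF x] by (intro univ_psub_le p x inst_Substs \<sigma> that Dom_closed d)
  qed
next
  assume all: "\<forall>d\<in>Dom. holds p (\<sigma>(x := d))"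
  define d where "d = (\<lambda>h\<in>Asg. h (wit x p \<sigma>))"
  have "d \<in> Dom" unfolding d_def by (rule point_Dom)
  then have "holds p (\<sigma>(x := d))" and upd: "\<sigma>(x := d) \<in> X \<rightarrow> Dom" using all \<sigma> by auto
  then have 1: "(\<lambda>h. psub p (inst (\<sigma>(x := d)) h)) \<in> M" by (simp add: holds_def)
  have 2: "henk x p \<sigma> \<in> M" using M_henkin x p \<sigma> unfolding henkin_axioms_def by blast
  show "holds (univ A X x p) \<sigma>"
    unfolding holds_def
  proof (rule M_entails[of "{\<lambda>h. psub p (inst (\<sigma>(x := d)) h), henk x p \<sigma>}"])
    show "(\<lambda>h. psub (univ A X x p) (inst \<sigma> h)) \<in> PForms"
      by (intro psub_inst_PForms univ_closed p x \<sigma>)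
    fix h q assume h: "h \<in> Asg" and q: "q \<in> P"
      and le: "\<And>k. k \<in> {\<lambda>h. psub p (inst (\<sigma>(x := d)) h), henk x p \<sigma>} \<Longrightarrow> q \<sqsubseteq>\<^bsub>L\<^esub> k h"
    let ?a = "psub p ((inst \<sigma> h)(x := h (wit x p \<sigma>)))" and ?g = "psub (univ A X x p) (inst \<sigma> h)"
    have a: "?a \<in> P" by (intro psub_closed upd_Substs inst_Substs Asg_closed p x \<sigma> h)
    have g: "?g \<in> P" by (intro psub_closed univ_closed inst_Substs p x \<sigma> h)
    have "q \<sqsubseteq>\<^bsub>L\<^esub> ?a"
      using le[of "\<lambda>h. psub p (inst (\<sigma>(x := d)) h)"] h by (simp add: inst_upd[OF x] d_def)
    then have qa: "q \<sqinter>\<^bsub>L\<^esub> L.compl ?a = \<bottom>\<^bsub>L\<^esub>" using L.meet_compl_eq_bottom_iff[OF q a] by blast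
    have "q \<sqsubseteq>\<^bsub>L\<^esub> L.compl ?a \<squnion>\<^bsub>L\<^esub> ?g" using le[of "henk x p \<sigma>"] by (simp add: henk_def)
    moreover have "L.compl ?a \<squnion>\<^bsub>L\<^esub> ?g \<in> P" by (intro L.join_closed L.compl_closed a g)
    \<comment> \<open>Modus ponens below \<open>q\<close>: the first joinand of the axiom is
      disjoint from \<open>q\<close>, so only the second remains.\<close>
    ultimately have "q = q \<sqinter>\<^bsub>L\<^esub> (L.compl ?a \<squnion>\<^bsub>L\<^esub> ?g)" using L.le_iff_join[OF q] by blast
    also have "\<dots> = (q \<sqinter>\<^bsub>L\<^esub> L.compl ?a) \<squnion>\<^bsub>L\<^esub> (q \<sqinter>\<^bsub>L\<^esub> ?g)"
      by (intro L.meet_join_distrib L.compl_closed q a g)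
    also have "\<dots> \<sqsubseteq>\<^bsub>L\<^esub> ?g"
      unfolding qa using L.meet_right[OF q g] L.meet_closed[OF q g] g by (intro L.join_le) auto
    finally show "q \<sqsubseteq>\<^bsub>L\<^esub> ?g" .
  qed (use 1 2 in auto)
qed

end

section \<open>The model\<close>

context complete_henkin_set
begin

text \<open>Functions in \<open>PForms\<close> are unrestricted outside \<open>Asg\<close>, so P2
  and the like give equality only on \<open>Asg\<close>; membership in \<open>M\<close> sees no more
  than that.\<close>

lemma M_ext:
  assumes "f \<in> PForms" "g \<in> PForms" "\<And>h. h \<in> Asg \<Longrightarrow> f h = g h"
  shows "f \<in> M \<longleftrightarrow> g \<in> M"
proof
  have le: "f h \<sqsubseteq>\<^bsub>L\<^esub> g h" "g h \<sqsubseteq>\<^bsub>L\<^esub> f h" if "h \<in> Asg" for h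
    unfolding assms(3)[OF that] by (rule L.le_refl[OF PFormsD[OF assms(2) that]])+
  show "f \<in> M \<Longrightarrow> g \<in> M" by (rule M_mono[OF _ assms(2) le(1)])
  show "g \<in> M \<Longrightarrow> f \<in> M" by (rule M_mono[OF _ assms(1) le(2)])
qed

text \<open>\<open>Inl\<close> is reserved for the terms of the algebra. The singleton only fits the
  code into the type \<open>room\<close>.\<close>

definition emb :: "((('a + 'b) list \<Rightarrow> 'a) \<Rightarrow> 'a) \<Rightarrow> 'a + ('a, 'b) room" where
  "emb d = Inr {code d}"

definition dec :: "'a + ('a, 'b) room \<Rightarrow> (('a + 'b) list \<Rightarrow> 'a) \<Rightarrow> 'a" where
  "dec = inv_into Dom emb"

definition lower :: "('v \<Rightarrow> 'a + ('a, 'b) room) \<Rightarrow> 'v \<Rightarrow> 'a" where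
  "lower \<sigma> = (\<lambda>x\<in>X. projl (\<sigma> x))"

text \<open>The target decides: into the empty set, domain elements are decoded, instantiated and
  coded again; otherwise \<open>lower\<close> and \<open>projl\<close> strip the injection
  \<open>Inl\<close>. Formulas over the empty set must have type \<open>'b\<close>, hence the truth
  values \<bottom> and \<top> of \<open>L\<close>.\<close>

definition model :: "('v, 'a + ('a, 'b) room, 'b) qtheory" where
  "model = \<lparr>
     terms = (\<lambda>Y. if Y = {} then emb ` Dom else Inl ` terms A Y),
     forms = (\<lambda>Y. if Y = {} then two_lattice \<bottom>\<^bsub>L\<^esub> \<top>\<^bsub>L\<^esub> else forms A Y),
     var = (\<lambda>Y. \<lambda>y\<in>Y. Inl (var A Y y)),
     tsubst = (\<lambda>Y Z a \<sigma>. if Z = {} then emb (\<lambda>h\<in>Asg. tsub (projl a) (inst (dec \<circ> \<sigma>) h))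
       else Inl (tsub (projl a) (lower \<sigma>))),
     psubst = (\<lambda>Y Z p \<sigma>. if Z = {} then (if holds p (dec \<circ> \<sigma>) then \<top>\<^bsub>L\<^esub> else \<bottom>\<^bsub>L\<^esub>)
       else psub p (lower \<sigma>)),
     univ = univ A\<rparr>"

lemma inj_emb: "inj_on emb Dom"
  using inj_code by (auto simp: inj_on_def emb_def)

lemma dec_emb: "d \<in> Dom \<Longrightarrow> dec (emb d) = d"
  unfolding dec_def by (rule inv_into_f_f[OF inj_emb])

lemma dec_Dom: "c \<in> emb ` Dom \<Longrightarrow> dec c \<in> Dom"
  unfolding dec_def by (rule inv_into_into)

lemma emb_dec: "c \<in> emb ` Dom \<Longrightarrow> emb (dec c) = c"
  unfolding dec_def using f_inv_into_f[of c emb Dom] .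

lemma model_empty:
  "terms model {} = emb ` Dom"
  "forms model {} = two_lattice \<bottom>\<^bsub>L\<^esub> \<top>\<^bsub>L\<^esub>"
  "tsubst model Y {} a \<sigma> = emb (\<lambda>h\<in>Asg. tsub (projl a) (inst (dec \<circ> \<sigma>) h))"
  "psubst model Y {} p \<sigma> = (if holds p (dec \<circ> \<sigma>) then \<top>\<^bsub>L\<^esub> else \<bottom>\<^bsub>L\<^esub>)"
  by (simp_all add: model_def)

lemma model_X:
  "terms model X = Inl ` T"
  "forms model X = L"
  "tsubst model Y X a \<sigma> = Inl (tsub (projl a) (lower \<sigma>))"
  "psubst model Y X p \<sigma> = psub p (lower \<sigma>)"
  using vars_nonempty by (simp_all add: model_def)

lemma model_var: "var model Y = (\<lambda>y\<in>Y. Inl (var A Y y))"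
  by (simp add: model_def)

lemma model_univ: "univ model = univ A"
  by (simp add: model_def)

lemma lower_Substs: "\<sigma> \<in> X \<rightarrow>\<^sub>E Inl ` T \<Longrightarrow> lower \<sigma> \<in> Substs"
  by (auto simp: lower_def PiE_iff)

lemma lower_upd: "x \<in> X \<Longrightarrow> lower (\<sigma>(x := Inl t)) = (lower \<sigma>)(x := t)"
  by (intro ext) (simp add: lower_def)

lemma lower_var: "lower (var model X) = var A X"
  using var_Substs by (intro ext) (auto simp: lower_def model_var PiE_iff extensional_def)

lemma lower_Inl: "lower (\<lambda>x\<in>X. Inl (\<sigma> x)) = restrict \<sigma> X"
  by (intro ext) (simp add: lower_def)

lemma dec_Pi: "\<sigma> \<in> X \<rightarrow>\<^sub>E emb ` Dom \<Longrightarrow> dec \<circ> \<sigma> \<in> X \<rightarrow> Dom"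
  by (simp add: PiE_iff Pi_iff dec_Dom)

lemma dec_upd: "d \<in> Dom \<Longrightarrow> dec \<circ> (\<sigma>(x := emb d)) = (dec \<circ> \<sigma>)(x := d)"
  by (intro ext) (simp add: dec_emb)

lemma lower_scomp: "lower (scomp model X X X \<sigma> \<tau>) = scomp A X X X (lower \<sigma>) (lower \<tau>)"
  by (intro ext) (simp add: lower_def scomp_def model_X)

text \<open>This reduces P2 with an empty target to P2 of the algebra at each assignment
  \<open>h\<close>. The composite can be decoded because \<open>tsub_inst_Dom\<close> keeps its
  values in \<open>Dom\<close>.\<close>

lemma inst_dec_scomp:
  assumes \<sigma>: "\<sigma> \<in> X \<rightarrow>\<^sub>E Inl ` T" and \<tau>: "\<tau> \<in> X \<rightarrow>\<^sub>E emb ` Dom" and h: "h \<in> Asg"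
  shows "inst (dec \<circ> scomp model X X {} \<sigma> \<tau>) h = scomp A X X X (lower \<sigma>) (inst (dec \<circ> \<tau>) h)"
proof
  fix x
  show "inst (dec \<circ> scomp model X X {} \<sigma> \<tau>) h x = scomp A X X X (lower \<sigma>) (inst (dec \<circ> \<tau>) h) x"
  proof (cases "x \<in> X")
    case True
    then have "projl (\<sigma> x) \<in> T" using \<sigma> by (auto simp: PiE_iff)
    then have "(\<lambda>h\<in>Asg. tsub (projl (\<sigma> x)) (inst (dec \<circ> \<tau>) h)) \<in> Dom"
      using dec_Pi[OF \<tau>] by (rule tsub_inst_Dom)
    then show ?thesis
      unfolding inst_def[of "dec \<circ> scomp model X X {} \<sigma> \<tau>"]
      using True h by (simp add: scomp_def lower_def model_empty dec_emb)
  qed (simp add: inst_def scomp_def)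
qed

lemma scomp_model_Substs:
  assumes "\<sigma> \<in> X \<rightarrow>\<^sub>E Inl ` T" "\<tau> \<in> X \<rightarrow>\<^sub>E emb ` Dom"
  shows "scomp model X X {} \<sigma> \<tau> \<in> X \<rightarrow>\<^sub>E emb ` Dom"
proof -
  have "(\<lambda>h\<in>Asg. tsub (projl (\<sigma> x)) (inst (dec \<circ> \<tau>) h)) \<in> Dom" if "x \<in> X" for x
    using assms(1) that by (intro tsub_inst_Dom dec_Pi[OF assms(2)]) (auto simp: PiE_iff)
  then show ?thesis by (simp add: scomp_def model_empty)
qed

lemma psub_psub_inst:
  assumes p: "p \<in> P" and \<sigma>: "\<sigma> \<in> X \<rightarrow>\<^sub>E Inl ` T" and \<tau>: "\<tau> \<in> X \<rightarrow>\<^sub>E emb ` Dom"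
  shows "holds (psub p (lower \<sigma>)) (dec \<circ> \<tau>) \<longleftrightarrow> holds p (dec \<circ> scomp model X X {} \<sigma> \<tau>)"
  unfolding holds_def
proof (rule M_ext)
  show "(\<lambda>h. psub (psub p (lower \<sigma>)) (inst (dec \<circ> \<tau>) h)) \<in> PForms"
    by (intro psub_inst_PForms psub_closed p lower_Substs \<sigma> dec_Pi \<tau>)
  show "(\<lambda>h. psub p (inst (dec \<circ> scomp model X X {} \<sigma> \<tau>) h)) \<in> PForms"
    by (intro psub_inst_PForms p dec_Pi scomp_model_Substs \<sigma> \<tau>)
  fix h assume h: "h \<in> Asg"
  show "psub (psub p (lower \<sigma>)) (inst (dec \<circ> \<tau>) h) = psub p (inst (dec \<circ> scomp model X X {} \<sigma> \<tau>) h)"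
    unfolding inst_dec_scomp[OF \<sigma> \<tau> h]
    by (rule P2_form) (use vars_nonempty p lower_Substs[OF \<sigma>] inst_Substs[OF dec_Pi[OF \<tau>] h] in auto)
qed

text \<open>New work arises only for substitutions with an empty target: P2 and P3 are checked at
  each assignment, and P4 comes from the homomorphism properties of \<open>holds\<close>. P5 and Q1
  to Q3 involve variables, which the empty set lacks, and are inherited.\<close>

lemma model_pre: "pre_quantifier_theory {{}, X} model"
proof (rule pre_quantifier_theory.intro)
  show "\<exists>Y\<in>{{}, X}. infinite Y" using infinite_vars by blast
next
  fix Y assume Y: "Y \<in> {{}, X}"
  show "var model Y \<in> Y \<rightarrow>\<^sub>E terms model Y"
  proof (cases "Y = {}")
    case False
    then show ?thesis using Y var_closed by (simp add: model_var model_X)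
  next
    case True
    then show ?thesis by (auto simp: model_var)
  qed
  show "boolean_lattice (forms model Y)"
  proof (cases "Y = {}")
    case True
    then show ?thesis using two_lattice_boolean[OF bottom_neq_top] by (simp add: model_empty)
  next
    case False
    then show ?thesis using Y L.boolean_lattice_axioms by (simp add: model_X)
  qed
next
  fix Y Z a \<sigma>
  assume *: "Y \<in> {{}, X}" "Y \<noteq> {}" "Z \<in> {{}, X}" "a \<in> terms model Y" "\<sigma> \<in> Y \<rightarrow>\<^sub>E terms model Z"
  then have Y: "Y = X" by blast
  have a: "projl a \<in> T" using *(4) by (auto simp: Y model_X)
  show "tsubst model Y Z a \<sigma> \<in> terms model Z"
  proof (cases "Z = {}")
    case True
    then have "\<sigma> \<in> X \<rightarrow>\<^sub>E emb ` Dom" using *(5) by (simp add: Y model_empty)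
    then show ?thesis using True a by (simp add: model_empty tsub_inst_Dom dec_Pi)
  next
    case False
    then have Z: "Z = X" using *(3) by blast
    then have "\<sigma> \<in> X \<rightarrow>\<^sub>E Inl ` T" using *(5) by (simp add: Y model_X)
    then show ?thesis using a by (simp add: Z model_X tsub_closed lower_Substs)
  qed
next
  fix Y Z p \<sigma>
  assume *: "Y \<in> {{}, X}" "Y \<noteq> {}" "Z \<in> {{}, X}" "p \<in> carrier (forms model Y)"
    "\<sigma> \<in> Y \<rightarrow>\<^sub>E terms model Z"
  then have Y: "Y = X" by blast
  have p: "p \<in> P" using *(4) by (simp add: Y model_X)
  show "psubst model Y Z p \<sigma> \<in> carrier (forms model Z)"
  proof (cases "Z = {}")
    case True
    then show ?thesis by (simp add: model_empty two_lattice_def)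
  next
    case False
    then have Z: "Z = X" using *(3) by blast
    then have "\<sigma> \<in> X \<rightarrow>\<^sub>E Inl ` T" using *(5) by (simp add: Y model_X)
    then show ?thesis using p by (simp add: Z model_X psub_closed lower_Substs)
  qed
next
  fix Y x p assume *: "Y \<in> {{}, X}" "x \<in> Y" "p \<in> carrier (forms model Y)"
  then have Y: "Y = X" by blast
  show "univ model Y x p \<in> carrier (forms model Y)"
    using *(2,3) by (simp add: Y model_X model_univ univ_closed)
next
  fix Y a assume *: "Y \<in> {{}, X}" "Y \<noteq> {}" "a \<in> terms model Y"
  then have Y: "Y = X" by blast
  obtain b where b: "a = Inl b" "b \<in> T" using *(3) by (auto simp: Y model_X)
  show "tsubst model Y Y a (var model Y) = a"
    using P1_term[OF _ vars_nonempty b(2)] by (simp add: Y model_X lower_var b(1))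
next
  fix Y p assume *: "Y \<in> {{}, X}" "Y \<noteq> {}" "p \<in> carrier (forms model Y)"
  then have Y: "Y = X" by blast
  then have p: "p \<in> P" using *(3) by (simp add: model_X)
  show "psubst model Y Y p (var model Y) = p"
    using P1_form[OF _ vars_nonempty p] by (simp add: Y model_X lower_var)
next
  fix Y Z W a \<sigma> \<tau>
  assume *: "Y \<in> {{}, X}" "Y \<noteq> {}" "Z \<in> {{}, X}" "Z \<noteq> {}" "W \<in> {{}, X}" "a \<in> terms model Y"
    "\<sigma> \<in> Y \<rightarrow>\<^sub>E terms model Z" "\<tau> \<in> Z \<rightarrow>\<^sub>E terms model W"
  then have YZ: "Y = X" "Z = X" by blast+
  have a: "projl a \<in> T" using *(6) by (auto simp: YZ model_X)
  have \<sigma>: "\<sigma> \<in> X \<rightarrow>\<^sub>E Inl ` T" using *(7) by (simp add: YZ model_X)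
  show "tsubst model Z W (tsubst model Y Z a \<sigma>) \<tau> = tsubst model Y W a (scomp model Y Z W \<sigma> \<tau>)"
  proof (cases "W = {}")
    case True
    then have \<tau>: "\<tau> \<in> X \<rightarrow>\<^sub>E emb ` Dom" using *(8) by (simp add: YZ model_empty)
    have "tsub (tsub (projl a) (lower \<sigma>)) (inst (dec \<circ> \<tau>) h) =
        tsub (projl a) (inst (dec \<circ> scomp model X X {} \<sigma> \<tau>) h)" if h: "h \<in> Asg" for h
      unfolding inst_dec_scomp[OF \<sigma> \<tau> h]
      by (rule P2_term) (use vars_nonempty a lower_Substs[OF \<sigma>] inst_Substs[OF dec_Pi[OF \<tau>] h] in auto)
    then have "(\<lambda>h\<in>Asg. tsub (tsub (projl a) (lower \<sigma>)) (inst (dec \<circ> \<tau>) h)) =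
        (\<lambda>h\<in>Asg. tsub (projl a) (inst (dec \<circ> scomp model X X {} \<sigma> \<tau>) h))"
      by (intro restrict_ext)
    then show ?thesis unfolding True YZ model_empty model_X by (simp only: sum.sel)
  next
    case False
    then have W: "W = X" using *(5) by blast
    then have \<tau>: "\<tau> \<in> X \<rightarrow>\<^sub>E Inl ` T" using *(8) by (simp add: YZ model_X)
    have "tsub (tsub (projl a) (lower \<sigma>)) (lower \<tau>) =
        tsub (projl a) (scomp A X X X (lower \<sigma>) (lower \<tau>))"
      by (rule P2_term) (use vars_nonempty a lower_Substs[OF \<sigma>] lower_Substs[OF \<tau>] in auto)
    then show ?thesis unfolding W YZ model_X lower_scomp by (simp only: sum.sel)
  qed
next
  fix Y Z W p \<sigma> \<tau>
  assume *: "Y \<in> {{}, X}" "Y \<noteq> {}" "Z \<in> {{}, X}" "Z \<noteq> {}" "W \<in> {{}, X}"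
    "p \<in> carrier (forms model Y)" "\<sigma> \<in> Y \<rightarrow>\<^sub>E terms model Z" "\<tau> \<in> Z \<rightarrow>\<^sub>E terms model W"
  then have YZ: "Y = X" "Z = X" by blast+
  have p: "p \<in> P" using *(6) by (simp add: YZ model_X)
  have \<sigma>: "\<sigma> \<in> X \<rightarrow>\<^sub>E Inl ` T" using *(7) by (simp add: YZ model_X)
  show "psubst model Z W (psubst model Y Z p \<sigma>) \<tau> = psubst model Y W p (scomp model Y Z W \<sigma> \<tau>)"
  proof (cases "W = {}")
    case True
    then have \<tau>: "\<tau> \<in> X \<rightarrow>\<^sub>E emb ` Dom" using *(8) by (simp add: YZ model_empty)
    show ?thesis unfolding True YZ model_empty model_X psub_psub_inst[OF p \<sigma> \<tau>] ..
  next
    case False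
    then have W: "W = X" using *(5) by blast
    then have \<tau>: "\<tau> \<in> X \<rightarrow>\<^sub>E Inl ` T" using *(8) by (simp add: YZ model_X)
    show ?thesis unfolding W YZ model_X lower_scomp
      by (rule P2_form) (use vars_nonempty p lower_Substs[OF \<sigma>] lower_Substs[OF \<tau>] in auto)
  qed
next
  fix Y x Z \<sigma>
  assume *: "Y \<in> {{}, X}" "x \<in> Y" "Z \<in> {{}, X}" "\<sigma> \<in> Y \<rightarrow>\<^sub>E terms model Z"
  then have Y: "Y = X" by blast
  have x: "x \<in> X" using *(2) Y by simp
  have v: "projl (var model X x) = var A X x" using x by (simp add: model_var)
  show "tsubst model Y Z (var model Y x) \<sigma> = \<sigma> x"
  proof (cases "Z = {}")
    case True
    then have \<sigma>: "\<sigma> \<in> X \<rightarrow>\<^sub>E emb ` Dom" using *(4) by (simp add: Y model_empty)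
    then have c: "\<sigma> x \<in> emb ` Dom" using x by (auto simp: PiE_iff)
    have "tsub (var A X x) (inst (dec \<circ> \<sigma>) h) = dec (\<sigma> x) h" if "h \<in> Asg" for h
      using P3[OF _ x _ inst_Substs[OF dec_Pi[OF \<sigma>] that]] x by (simp add: inst_def)
    then have "(\<lambda>h\<in>Asg. tsub (var A X x) (inst (dec \<circ> \<sigma>) h)) = restrict (dec (\<sigma> x)) Asg"
      by (intro restrict_ext)
    also have "\<dots> = dec (\<sigma> x)"
      using dec_Dom[OF c] by (auto simp: Dom_def intro: extensional_restrict)
    finally show ?thesis unfolding True Y model_empty v by (simp add: emb_dec[OF c])
  next
    case False
    then have Z: "Z = X" using *(3) by blast
    then have \<sigma>: "\<sigma> \<in> X \<rightarrow>\<^sub>E Inl ` T" using *(4) by (simp add: Y model_X)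
    then obtain b where "\<sigma> x = Inl b" using x by (auto simp: PiE_iff)
    then show ?thesis unfolding Z Y model_X v
      using P3[OF _ x _ lower_Substs[OF \<sigma>]] x by (simp add: lower_def)
  qed
next
  fix Y Z \<sigma>
  assume *: "Y \<in> {{}, X}" "Y \<noteq> {}" "Z \<in> {{}, X}" "\<sigma> \<in> Y \<rightarrow>\<^sub>E terms model Z"
  then have Y: "Y = X" by blast
  show "boolean_hom (forms model Y) (forms model Z) (\<lambda>p. psubst model Y Z p \<sigma>)"
  proof (cases "Z = {}")
    case True
    then have "\<sigma> \<in> X \<rightarrow>\<^sub>E emb ` Dom" using *(4) by (simp add: Y model_empty)
    note d = dec_Pi[OF this]
    show ?thesis unfolding True Y model_empty model_X
      by (rule boolean_hom_two_lattice[OF bottom_neq_top L.boolean_lattice_axioms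
            holds_bottom[OF d] holds_top[OF d] holds_meet[OF d] holds_join[OF d]])
  next
    case False
    then have Z: "Z = X" using *(3) by blast
    then have "\<sigma> \<in> X \<rightarrow>\<^sub>E Inl ` T" using *(4) by (simp add: Y model_X)
    then show ?thesis unfolding Z Y model_X by (intro psub_hom lower_Substs)
  qed
next
  fix Y x Z p \<sigma> y z
  assume *: "Y \<in> {{}, X}" "x \<in> Y" "Z \<in> {{}, X}" "p \<in> carrier (forms model Y)"
    "\<sigma> \<in> Y \<rightarrow>\<^sub>E terms model Z" "y \<in> Z" "z \<in> Z" "y \<noteq> z"
    and eq: "scomp model Y Z Z \<sigma> ((var model Z)(y := var model Z z)) = \<sigma>"
  then have YZ: "Y = X" "Z = X" by blast+
  have p: "p \<in> P" and x: "x \<in> X" and y: "y \<in> X" and z: "z \<in> X" using * by (auto simp: YZ model_X)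
  have \<sigma>: "\<sigma> \<in> X \<rightarrow>\<^sub>E Inl ` T" using *(5) by (simp add: YZ model_X)
  have v: "var model X u = Inl (var A X u)" if "u \<in> X" for u using that by (simp add: model_var)
  have "scomp A X X X (lower \<sigma>) ((var A X)(y := var A X z)) =
      lower (scomp model X X X \<sigma> ((var model X)(y := var model X z)))"
    unfolding lower_scomp v[OF z] lower_upd[OF y] lower_var ..
  also have "\<dots> = lower \<sigma>" using eq unfolding YZ by simp
  finally have "psub (univ A X x p) (lower \<sigma>) = univ A X y (psub p ((lower \<sigma>)(x := var A X y)))"
    by (intro P5[OF _ x _ p lower_Substs[OF \<sigma>] y z *(8)]) simp_all
  then show "psubst model Y Z (univ model Y x p) \<sigma> =
      univ model Z y (psubst model Y Z p (\<sigma>(x := var model Z y)))"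
    unfolding YZ model_X model_univ v[OF y] lower_upd[OF x] .
next
  fix Y x p q
  assume *: "Y \<in> {{}, X}" "x \<in> Y" "p \<in> carrier (forms model Y)" "q \<in> carrier (forms model Y)"
  then have Y: "Y = X" by blast
  show "univ model Y x (p \<sqinter>\<^bsub>forms model Y\<^esub> q) = univ model Y x p \<sqinter>\<^bsub>forms model Y\<^esub> univ model Y x q"
    using * unfolding Y model_X model_univ by (intro Q1) simp_all
next
  fix Y x p
  assume *: "Y \<in> {{}, X}" "x \<in> Y" "p \<in> carrier (forms model Y)"
  then have Y: "Y = X" by blast
  show "univ model Y x p \<sqsubseteq>\<^bsub>forms model Y\<^esub> p"
    using * unfolding Y model_X model_univ by (intro Q2) simp_all
next
  fix Y x p y
  assume *: "Y \<in> {{}, X}" "x \<in> Y" "p \<in> carrier (forms model Y)" "y \<in> Y" "y \<noteq> x"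
    and eq: "psubst model Y Y p ((var model Y)(x := var model Y y)) = p"
  then have Y: "Y = X" by blast
  have x: "x \<in> X" and y: "y \<in> X" and p: "p \<in> P" using * by (simp_all add: Y model_X)
  have "var model X y = Inl (var A X y)" using y by (simp add: model_var)
  then have "psub p ((var A X)(x := var A X y)) = p"
    using eq unfolding Y model_X by (simp only: lower_upd[OF x] lower_var)
  then show "univ model Y x p = p"
    unfolding Y model_univ by (intro Q3[OF _ x p y *(5)]) simp_all
qed

lemma restriction_equals_model: "restriction_equals {X} A model"
  unfolding restriction_equals_def
  by (auto simp: model_X model_var model_univ lower_Inl PiE_restrict)

text \<open>M2 is \<open>holds_univ\<close> read in the two-element algebra. Nontriviality is
  inherited, as a formula closed in the model is closed in the algebra.\<close>

lemma model_two_model: "two_model {{}, X} model"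
proof -
  interpret pre_quantifier_theory "{{}, X}" model by (rule model_pre)
  show ?thesis
  proof
    obtain p where p: "p \<in> P" "\<not> form_support {X} A X p {}"
      using nontrivial by blast
    have "\<not> form_support {{}, X} model X p {}"
    proof
      assume s: "form_support {{}, X} model X p {}"
      have "psub p \<sigma> = psub p \<tau>" if st: "\<sigma> \<in> Substs" "\<tau> \<in> Substs" for \<sigma> \<tau>
      proof -
        have "(\<lambda>x\<in>X. Inl (\<sigma> x)) \<in> X \<rightarrow>\<^sub>E terms model X" "(\<lambda>x\<in>X. Inl (\<tau> x)) \<in> X \<rightarrow>\<^sub>E terms model X"
          using st by (auto simp: model_X)
        then have "psubst model X X p (\<lambda>x\<in>X. Inl (\<sigma> x)) = psubst model X X p (\<lambda>x\<in>X. Inl (\<tau> x))"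
          using s unfolding form_support_def by blast
        then show ?thesis unfolding model_X lower_Inl PiE_restrict[OF st(1)] PiE_restrict[OF st(2)] .
      qed
      then show False using p(2) unfolding form_support_def by blast
    qed
    then show "\<exists>Y\<in>{{}, X}. Y \<noteq> {} \<and> (\<exists>p\<in>carrier (forms model Y). \<not> form_support {{}, X} model Y p {})"
      using p(1) vars_nonempty unfolding model_X(2)[symmetric] by blast
    show "{} \<in> {{}, X}" by simp
    show "terms model {} \<noteq> {}" unfolding model_empty using point_Dom by blast
    show "\<bottom>\<^bsub>forms model {}\<^esub> \<noteq> \<top>\<^bsub>forms model {}\<^esub>"
      unfolding model_empty two_lattice_bounds[OF bottom_neq_top] by (rule bottom_neq_top)
    show "carrier (forms model {}) = {\<bottom>\<^bsub>forms model {}\<^esub>, \<top>\<^bsub>forms model {}\<^esub>}"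
      unfolding model_empty two_lattice_bounds[OF bottom_neq_top] by (simp add: two_lattice_def)
    fix Y x p \<sigma>
    assume *: "Y \<in> {{}, X}" "x \<in> Y" "p \<in> carrier (forms model Y)" "\<sigma> \<in> Y \<rightarrow>\<^sub>E terms model {}"
    then have Y: "Y = X" by blast
    have x: "x \<in> X" and p: "p \<in> P" and \<sigma>: "\<sigma> \<in> X \<rightarrow>\<^sub>E emb ` Dom"
      using * by (simp_all add: Y model_X model_empty)
    have "(\<lambda>d. psubst model X {} p (\<sigma>(x := d))) ` terms model {} =
        (\<lambda>d. if holds p ((dec \<circ> \<sigma>)(x := d)) then \<top>\<^bsub>L\<^esub> else \<bottom>\<^bsub>L\<^esub>) ` Dom"
      unfolding model_empty image_image by (intro image_cong refl) (simp only: dec_upd)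
    then show "is_glb (forms model {}) (psubst model Y {} (univ model Y x p) \<sigma>)
        ((\<lambda>d. psubst model Y {} p (\<sigma>(x := d))) ` terms model {})"
      unfolding Y model_univ model_empty(2) model_empty(4)[of X "univ A X x p"]
        holds_univ[OF x p dec_Pi[OF \<sigma>]]
      by (simp only: two_lattice_glb[OF bottom_neq_top])
  qed
qed

lemma two_model_of_model: "two_model_of {X} A model"
proof -
  have "{X} - {{}} = {X}" using vars_nonempty by auto
  then show ?thesis
    using model_two_model restriction_equals_model unfolding two_model_of_def by simp
qed

lemma std_model_Substs: "(\<lambda>x\<in>X. emb (std x)) \<in> X \<rightarrow>\<^sub>E terms model {}"
  using std_Dom by (simp add: model_empty Pi_iff)

lemma psubst_model_std:
  "psubst model X {} p (\<lambda>x\<in>X. emb (std x)) = (if holds p std then \<top>\<^bsub>L\<^esub> else \<bottom>\<^bsub>L\<^esub>)"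
proof -
  have "holds p (dec \<circ> (\<lambda>x\<in>X. emb (std x))) \<longleftrightarrow> holds p std"
    using std_Dom by (intro holds_cong) (simp add: Pi_iff dec_emb)
  then show ?thesis by (simp add: model_empty)
qed

end

section \<open>Models from consistent sets\<close>

context locally_finite_algebra
begin

lemma complete_henkin_set_exists:
  assumes "J \<subseteq> P" "consistent L J"
  obtains M where "complete_henkin_set X A M" "\<And>p. p \<in> J \<Longrightarrow> (\<lambda>h. psub p (inst std h)) \<in> M"
proof -
  let ?K = "(\<lambda>p h. psub p (inst std h)) ` J \<union> henkin_axioms"
  have "?K \<subseteq> PForms"
    using assms(1) std_Dom
    by (auto simp: PForms_def henkin_axioms_def intro!: psub_closed inst_Substs henk_closed)
  then obtain M where M: "?K \<subseteq> M" "M \<subseteq> PForms" "satisfiable M"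
    and max: "\<And>g. \<lbrakk>g \<in> PForms; satisfiable (insert g M)\<rbrakk> \<Longrightarrow> g \<in> M"
    by (rule maximal_satisfiable[OF _ henkin_satisfiable[OF assms]]) blast
  have "complete_henkin_set X A M"
    by unfold_locales (use M max in auto)
  then show thesis by (rule that) (use M(1) in auto)
qed

text \<open>The required map sends each variable to the code of its own parameter, the instantiation
  under which \<open>J\<close> was put into \<open>M\<close>.\<close>

lemma consistent_model:
  assumes "J \<subseteq> P" "consistent L J"
  shows "\<exists>(B :: ('v, 'a + ('a, 'b) room, 'b) qtheory) \<sigma>.
    two_model_of {X} A B \<and> \<sigma> \<in> X \<rightarrow>\<^sub>E terms B {} \<and> (\<forall>p\<in>J. psubst B X {} p \<sigma> = \<top>\<^bsub>forms B {}\<^esub>)"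
proof -
  obtain M where "complete_henkin_set X A M"
    and J: "\<And>p. p \<in> J \<Longrightarrow> (\<lambda>h. psub p (inst std h)) \<in> M"
    using complete_henkin_set_exists[OF assms] by blast
  then interpret complete_henkin_set X A M by blast
  have "\<forall>p\<in>J. psubst model X {} p (\<lambda>x\<in>X. emb (std x)) = \<top>\<^bsub>forms model {}\<^esub>"
    unfolding psubst_model_std model_empty(2) two_lattice_bounds[OF bottom_neq_top]
    using J by (simp add: holds_def)
  then show ?thesis using two_model_of_model std_model_Substs by blast
qed

text \<open>The nonzero element p \<sqinter> compl q can be made true; then p is true and q is
  false. Of two different formulas at least one does not lie below the other, so this covers
  (b).\<close>

lemma separating_model:
  assumes "p \<in> P" "q \<in> P" "\<not> p \<sqsubseteq>\<^bsub>L\<^esub> q"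
  shows "\<exists>(B :: ('v, 'a + ('a, 'b) room, 'b) qtheory) \<sigma>.
    two_model_of {X} A B \<and> \<sigma> \<in> X \<rightarrow>\<^sub>E terms B {} \<and> psubst B X {} p \<sigma> \<noteq> psubst B X {} q \<sigma>"
proof -
  let ?r = "p \<sqinter>\<^bsub>L\<^esub> L.compl q"
  have c: "L.compl q \<in> P" using assms(2) by (rule L.compl_closed)
  have r: "?r \<in> P" using assms(1) c by (rule L.meet_closed)
  have "?r \<noteq> \<bottom>\<^bsub>L\<^esub>" using L.meet_compl_eq_bottom_iff[OF assms(1,2)] assms(3) by blast
  from consistent_singleton[OF L.boolean_lattice_axioms r this]
  obtain M where "complete_henkin_set X A M" and rM: "(\<lambda>h. psub ?r (inst std h)) \<in> M"
    using complete_henkin_set_exists[of "{?r}"] r by blast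
  then interpret complete_henkin_set X A M by blast
  have "holds p std" "holds (L.compl q) std"
    using rM holds_meet[OF std_Dom assms(1) c] by (simp_all add: holds_def)
  moreover from this have "\<not> holds q std"
    using holds_meet[OF std_Dom assms(2) c] holds_bottom[OF std_Dom]
    by (simp add: L.meet_compl[OF assms(2)])
  ultimately have "psubst model X {} p (\<lambda>x\<in>X. emb (std x)) \<noteq> psubst model X {} q (\<lambda>x\<in>X. emb (std x))"
    using bottom_neq_top by (simp add: psubst_model_std)
  then show ?thesis using two_model_of_model std_model_Substs by blast
qed

end

theorem theorem8:
  fixes A :: "('v, 'a, 'b) qtheory" and X :: "'v set"
  assumes "infinite X"
    and "quantifier_algebra X A"
    and "locally_finite {X} A"
  shows "(\<forall>J \<subseteq> carrier (forms A X). consistent (forms A X) J \<longrightarrow>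
      (\<exists>(B :: ('v, 'a + ('a, 'b) room, 'b) qtheory) \<sigma>.
         two_model_of {X} A B \<and> \<sigma> \<in> X \<rightarrow>\<^sub>E terms B {} \<and>
         (\<forall>p\<in>J. psubst B X {} p \<sigma> = \<top>\<^bsub>forms B {}\<^esub>))) \<and>
    (\<forall>p \<in> carrier (forms A X). \<forall>q \<in> carrier (forms A X). p \<noteq> q \<longrightarrow>
      (\<exists>(B :: ('v, 'a + ('a, 'b) room, 'b) qtheory) \<sigma>.
         two_model_of {X} A B \<and> \<sigma> \<in> X \<rightarrow>\<^sub>E terms B {} \<and>
         psubst B X {} p \<sigma> \<noteq> psubst B X {} q \<sigma>))"
proof -
  interpret quantifier_theory "{X}" A by fact
  interpret locally_finite_algebra X A by unfold_locales fact+
  show ?thesis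
  proof (intro conjI allI ballI impI)
    fix J assume "J \<subseteq> P" "consistent L J"
    then show "\<exists>(B :: ('v, 'a + ('a, 'b) room, 'b) qtheory) \<sigma>.
         two_model_of {X} A B \<and> \<sigma> \<in> X \<rightarrow>\<^sub>E terms B {} \<and>
         (\<forall>p\<in>J. psubst B X {} p \<sigma> = \<top>\<^bsub>forms B {}\<^esub>)"
      by (rule consistent_model)
  next
    fix p q assume p: "p \<in> P" and q: "q \<in> P" and "p \<noteq> q"
    then consider "\<not> p \<sqsubseteq>\<^bsub>L\<^esub> q" | "\<not> q \<sqsubseteq>\<^bsub>L\<^esub> p" using L.antisym by blast
    then show "\<exists>(B :: ('v, 'a + ('a, 'b) room, 'b) qtheory) \<sigma>.
         two_model_of {X} A B \<and> \<sigma> \<in> X \<rightarrow>\<^sub>E terms B {} \<and>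
         psubst B X {} p \<sigma> \<noteq> psubst B X {} q \<sigma>"
    proof cases
      case 1
      then show ?thesis by (rule separating_model[OF p q])
    next
      case 2
      then show ?thesis using separating_model[OF q p] by metis
    qed
  qed
qed

end
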